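(* Let $P=\{x\in M_{\mathbb R}:\langle a_i,x\rangle+b_i\ge0,\ i=1,\dots,m\}$ be a simple convex $n$-dimensional polytope with exactly $m$ facets, where $a_1,\dots,a_m\in N$ are primitive vectors and $b_1,\dots,b_m\in\mathbb Z$, let $\Sigma_P$ be its normal fan, $b_P=(b_1,\dots,b_m)^t\in\mathbb R^m$, and let $\mu_{\Sigma_P}\colon\mathbb C^m\to\mathfrak k^*\cong\mathbb R^{m-n}$, $\mu_{\Sigma_P}(z)=C(|z_1|^2,\dots,|z_m|^2)^t$, be the corresponding moment map (with $C$ as in the context). Then the toric Kempf--Ness set $\mathcal Z(\Sigma_P)$ for the $G$-action on $U(\Sigma_P)$ is given by $$\mathcal Z(\Sigma_P)\cong\mu_{\Sigma_P}^{-1}(Cb_P),$$ where $\cong$ denotes $\mathbb T^m$-equivariant homeomorphism.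
   Context: $N\cong\mathbb Z^n$ is a lattice, $N_{\mathbb R}=N\otimes_{\mathbb Z}\mathbb R$, and $M_{\mathbb R}=(N_{\mathbb R})^*$. The set $P$ is assumed bounded, with affine hull all of $M_{\mathbb R}$, and such that for each $i$ the intersection $F_i$ of $P$ with the hyperplane $\langle a_i,x\rangle+b_i=0$ spans an affine subspace of dimension $n-1$; so $P$ has exactly the $m$ facets $F_1,\dots,F_m$. $P$ is simple if exactly $n$ facets meet at each vertex. The normal fan $\Sigma_P$ is the collection of cones $\sigma_Q$, $Q$ a face of $P$, where $\sigma_Q\subset N_{\mathbb R}$ is the cone of nonnegative combinations of those $a_i$ with $Q\subset F_i$. It is a complete simplicial fan with one-dimensional cones generated by $a_1,\dots,a_m$. For $\sigma\in\Sigma_P$ let $g(\sigma)\subseteq\{1,\dots,m\}$ be the set of indices $i$ such that $a_i$ is a generator of $\sigma$. A subset of $\{1,\dots,m\}$ is called a $g$-subset if it is contained in $g(\sigma)$ for some $\sigma\in\Sigma_P$. Define $$U(\Sigma_P)=\mathbb C^m\setminus\bigcup_{\{i_1,\dots,i_k\}\text{ not a }g\text{-subset}}\{z\in\mathbb C^m: z_{i_1}=\dots=z_{i_k}=0\},$$ and the toric Kempf--Ness set $$\mathcal Z(\Sigma_P)=\bigcup_{\sigma\in\Sigma_P}\{z\in\mathbb C^m: |z_j|\le 1\text{ for all }j,\ |z_j|=1\text{ if }j\notin g(\sigma)\}\subset U(\Sigma_P).$$ Let $\mathbb T^m=(\mathbb S^1)^m$ act on $\mathbb C^m$ coordinatewise.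 The map $\mathbb Z^m\to N$ sending the $i$-th standard basis vector to $a_i$ induces homomorphisms $(\mathbb C^* )^m\to N\otimes_{\mathbb Z}\mathbb C^*$ and $\mathbb T^m\to N\otimes_{\mathbb Z}\mathbb S^1$ with kernels $G$ and $K$ respectively; $\mathfrak k$ is the Lie algebra of $K$. Let $A_P\colon M_{\mathbb R}\to\mathbb R^m$ be the linear map $x\mapsto(\langle a_1,x\rangle,\dots,\langle a_m,x\rangle)$. Choosing a basis of $\operatorname{coker}A_P$ gives an $(m-n)\times m$ matrix $C$ fitting into a short exact sequence $0\to M_{\mathbb R}\xrightarrow{A_P}\mathbb R^m\xrightarrow{C}\mathbb R^{m-n}\to0$. The moment map $\mu_{\Sigma_P}$ of the $K$-action is the composition of $\mathbb C^m\to\mathbb R^m$, $z\mapsto(|z_1|^2,\dots,|z_m|^2)$ (the moment map of the coordinatewise $\mathbb T^m$-action for the symplectic form $2\sum_k dx_k\wedge dy_k$, $z_k=x_k+iy_k$) with the restriction map $\mathbb R^m\to\mathfrak k^*$ dual to the inclusion of Lie algebras; under a choice of isomorphism $\mathfrak k^*\cong\mathbb R^{m-n}$ the map $\mathbb R^m\to\mathfrak k^*$ is given by the matrix $C$. *)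

theory Defs
  imports "HOL-Analysis.Analysis"
begin

text \<open>
  A basis of the lattice \<open>N\<close> identifies \<open>N\<close> with \<open>int ^ 'n\<close> and both \<open>N\<^sub>\<real>\<close> and its
  dual \<open>M\<^sub>\<real>\<close> (via the dual basis) with \<open>real ^ 'n\<close>; the pairing of \<open>N\<^sub>\<real>\<close> and
  \<open>M\<^sub>\<real>\<close> is then the dot product.
  The dimension \<open>n\<close> is \<open>CARD('n)\<close> and the index set \<open>{1, \<dots>, m}\<close> is the type \<open>'m\<close>.
\<close>

definition real_vec :: "int ^ 'i \<Rightarrow> real ^ 'i" where
  "real_vec v = (\<chi> j. real_of_int (v $ j))"

definition primitive_vec :: "int ^ 'n \<Rightarrow> bool" where
  "primitive_vec v \<longleftrightarrow> v \<noteq> 0 \<and> (\<forall>k w. v = k *s w \<longrightarrow> \<bar>k\<bar> = 1)"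

definition polytope_of :: "('m \<Rightarrow> int ^ 'n) \<Rightarrow> int ^ 'm \<Rightarrow> (real ^ 'n) set" where
  "polytope_of a b = {x. \<forall>i. real_vec (a i) \<bullet> x + real_of_int (b $ i) \<ge> 0}"

definition facet :: "('m \<Rightarrow> int ^ 'n) \<Rightarrow> int ^ 'm \<Rightarrow> 'm \<Rightarrow> (real ^ 'n) set" where
  "facet a b i = polytope_of a b \<inter> {x. real_vec (a i) \<bullet> x + real_of_int (b $ i) = 0}"

text \<open>
  The cardinality condition excludes repeated inequalities: without it, two different
  indices could define the same facet.
\<close>

definition irredundant_polytope :: "('m \<Rightarrow> int ^ 'n) \<Rightarrow> int ^ 'm \<Rightarrow> bool" where
  "irredundant_polytope a b \<longleftrightarrow>
     bounded (polytope_of a b) \<and>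
     affine hull (polytope_of a b) = UNIV \<and>
     (\<forall>i. aff_dim (facet a b i) = int CARD('n) - 1) \<and>
     card {F. F facet_of polytope_of a b} = CARD('m)"

definition simple_polytope :: "(real ^ 'n) set \<Rightarrow> bool" where
  "simple_polytope P \<longleftrightarrow>
     (\<forall>v. v extreme_point_of P \<longrightarrow> card {F. F facet_of P \<and> v \<in> F} = CARD('n))"

definition normal_cone :: "('m \<Rightarrow> int ^ 'n) \<Rightarrow> int ^ 'm \<Rightarrow> (real ^ 'n) set \<Rightarrow> (real ^ 'n) set" where
  "normal_cone a b Q = convex_cone hull ((\<lambda>i. real_vec (a i)) ` {i. Q \<subseteq> facet a b i})"

text \<open>
  The empty set is a face in the sense of \<^const>\<open>face_of\<close>, but it has no cone in the normal
  fan. The polytope itself contributes the zero cone.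
\<close>

definition normal_fan :: "('m \<Rightarrow> int ^ 'n) \<Rightarrow> int ^ 'm \<Rightarrow> (real ^ 'n) set set" where
  "normal_fan a b = {normal_cone a b Q | Q. Q face_of polytope_of a b \<and> Q \<noteq> {}}"

text \<open>
  A vector \<open>a i\<close> is a generator of a cone if it spans an edge, i.e. a one-dimensional face,
  of that cone.
\<close>

definition generator_indices :: "('m \<Rightarrow> int ^ 'n) \<Rightarrow> (real ^ 'n) set \<Rightarrow> 'm set" where
  "generator_indices a \<sigma> = {i. (convex_cone hull {real_vec (a i)}) face_of \<sigma>}"

definition kempf_ness_set :: "('m \<Rightarrow> int ^ 'n) \<Rightarrow> (real ^ 'n) set set \<Rightarrow> (complex ^ 'm) set" where
  "kempf_ness_set a \<Sigma> =
     (\<Union>\<sigma>\<in>\<Sigma>. {z. (\<forall>j. cmod (z $ j) \<le> 1) \<and> (\<forall>j. j \<notin> generator_indices a \<sigma> \<longrightarrow> cmod (z $ j) = 1)})"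

definition A_map :: "('m \<Rightarrow> int ^ 'n) \<Rightarrow> real ^ 'n \<Rightarrow> real ^ 'm" where
  "A_map a x = (\<chi> i. real_vec (a i) \<bullet> x)"

text \<open>
  Exactness of \<open>0 \<rightarrow> M\<^sub>\<real> \<rightarrow> \<real>\<^sup>m \<rightarrow> \<real>\<^sup>k \<rightarrow> 0\<close>, where \<open>k = CARD('k) = m - n\<close>.
\<close>

definition cokernel_matrix :: "('m \<Rightarrow> int ^ 'n) \<Rightarrow> real ^ 'm ^ 'k \<Rightarrow> bool" where
  "cokernel_matrix a C \<longleftrightarrow>
     CARD('n) + CARD('k) = CARD('m) \<and>
     inj (A_map a) \<and> range (A_map a) = {y. C *v y = 0} \<and> surj (\<lambda>y. C *v y)"

definition moment_map :: "real ^ 'm ^ 'k \<Rightarrow> complex ^ 'm \<Rightarrow> real ^ 'k" where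
  "moment_map C z = C *v (\<chi> i. (cmod (z $ i))\<^sup>2)"

definition torus :: "(complex ^ 'm) set" where
  "torus = {t. \<forall>j. cmod (t $ j) = 1}"

definition torus_act :: "complex ^ 'm \<Rightarrow> complex ^ 'm \<Rightarrow> complex ^ 'm" where
  "torus_act t z = (\<chi> j. t $ j * z $ j)"

definition equivariantly_homeomorphic :: "(complex ^ 'm) set \<Rightarrow> (complex ^ 'm) set \<Rightarrow> bool" where
  "equivariantly_homeomorphic S T \<longleftrightarrow>
     (\<forall>t\<in>torus. \<forall>z\<in>S. torus_act t z \<in> S) \<and>
     (\<forall>t\<in>torus. \<forall>z\<in>T. torus_act t z \<in> T) \<and>
     (\<exists>f g. homeomorphism S T f g \<and>
        (\<forall>t\<in>torus. \<forall>z\<in>S. f (torus_act t z) = torus_act t (f z)))"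

end

theory Submission
  imports Defs
begin

text \<open>
  Pass to the coordinates \<open>|z\<^sub>i|\<^sup>2\<close>, that is, to the quotients by the torus. The level set of the
  moment map becomes the polytope \<open>P\<close>, embedded in \<open>\<real>\<^sup>m\<close> by its slack vector
  \<open>y\<^sub>i = \<langle>a\<^sub>i, x\<rangle> + b\<^sub>i\<close>, and the Kempf--Ness set becomes a cubical complex: the vectors
  \<open>r \<in> [0, 1]\<^sup>m\<close> for which the facets \<open>F\<^sub>i\<close> with \<open>r\<^sub>i < 1\<close> have a common point. A homeomorphism
  between the two that preserves the vanishing of each coordinate lifts equivariantly.

  Such a homeomorphism is given by the relation that \<open>\<gamma>\<^sub>i = 1 / y\<^sub>i - 1 / r\<^sub>i\<close> is a linear relation
  \<open>\<Sum>\<^sub>i \<gamma>\<^sub>i a\<^sub>i = 0\<close>. For fixed \<open>r > 0\<close> this is the critical point equation of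
  \<open>\<Sum>\<^sub>i (ln y\<^sub>i - y\<^sub>i / r\<^sub>i)\<close> on the interior of \<open>P\<close>; for fixed \<open>y > 0\<close> it asks for the coordinates
  of the vector \<open>\<Sum>\<^sub>i (1 / y\<^sub>i - 1) a\<^sub>i\<close> in the complete simplicial normal fan. Uniqueness on either
  side follows by pairing \<open>\<gamma>\<close> with differences of slack vectors, to which it is orthogonal. The
  graph of the relation is compact, because the \<open>\<gamma>\<close> that occur along a convergent sequence are
  bounded; hence it is the graph of a homeomorphism, and the boundary is reached by density.
\<close>

section \<open>The cubical complex of a simple polytope\<close>

definition slack :: "('m \<Rightarrow> 'a::real_inner) \<Rightarrow> real ^ 'm \<Rightarrow> 'a \<Rightarrow> real ^ 'm" where
  "slack a b x = (\<chi> i. a i \<bullet> x + b $ i)"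

definition slack_polytope :: "('m \<Rightarrow> 'a::real_inner) \<Rightarrow> real ^ 'm \<Rightarrow> (real ^ 'm) set" where
  "slack_polytope a b = slack a b ` {x. \<forall>i. 0 \<le> slack a b x $ i}"

definition relations :: "('m::finite \<Rightarrow> 'a::real_vector) \<Rightarrow> (real ^ 'm) set" where
  "relations a = {\<gamma>. (\<Sum>i\<in>UNIV. \<gamma> $ i *\<^sub>R a i) = 0}"

text \<open>The witness \<open>y\<close> stands for a cone of the normal fan: its zero coordinates
  are the facets through one point of the polytope, and only these coordinates of \<open>r\<close>
  may drop below 1.\<close>

definition cube_complex :: "(real ^ 'm) set \<Rightarrow> (real ^ 'm) set" where
  "cube_complex H = {r. (\<forall>i. 0 \<le> r $ i \<and> r $ i \<le> 1) \<and> (\<exists>y\<in>H. \<forall>i. r $ i < 1 \<longrightarrow> y $ i = 0)}"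

text \<open>This is \<open>\<gamma>\<^sub>i = 1 / y\<^sub>i - 1 / r\<^sub>i\<close>, multiplied out so that coordinates with
  \<open>r\<^sub>i = y\<^sub>i = 0\<close> impose no condition.\<close>

definition linked :: "('m::finite \<Rightarrow> 'a::real_vector) \<Rightarrow> real ^ 'm \<Rightarrow> real ^ 'm \<Rightarrow> bool" where
  "linked a r y \<longleftrightarrow> (\<exists>\<gamma>\<in>relations a. \<forall>i. r $ i - y $ i = \<gamma> $ i * r $ i * y $ i)"

section \<open>Slack vectors and linear relations between the normals\<close>

lemma linked_zero_iff: "linked a r y \<Longrightarrow> r $ i = 0 \<longleftrightarrow> y $ i = 0"
  unfolding linked_def by (metis diff_0 diff_zero mult_zero_left mult_zero_right neg_equal_0_iff_equal)

lemma relations_diff: "\<gamma> \<in> relations a \<Longrightarrow> \<delta> \<in> relations a \<Longrightarrow> \<gamma> - \<delta> \<in> relations a"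
  by (simp add: relations_def scaleR_left_diff_distrib sum_subtractf)

lemma relations_scaleR: "\<gamma> \<in> relations a \<Longrightarrow> c *\<^sub>R \<gamma> \<in> relations a"
  by (simp add: relations_def flip: scaleR_scaleR scaleR_sum_right)

lemma closed_relations:
  fixes a :: "'m::finite \<Rightarrow> 'a::real_normed_vector"
  shows "closed (relations a)"
  unfolding relations_def by (intro closed_Collect_eq continuous_intros)

lemma slack_nonneg: "y \<in> slack_polytope a b \<Longrightarrow> 0 \<le> y $ i"
  by (auto simp: slack_polytope_def)

lemma slack_add_scaleR: "slack a b (x + t *\<^sub>R u) $ i = slack a b x $ i + t * (a i \<bullet> u)"
  by (simp add: slack_def inner_simps)

text \<open>In a difference of slack vectors \<open>b\<close> cancels, so it lies in the image of
  \<open>\<lambda>u. (\<chi> i. a i \<bullet> u)\<close>, whose orthogonal complement is the space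
  of relations.\<close>

lemma relations_orthogonal:
  assumes "\<gamma> \<in> relations a" "y \<in> slack_polytope a b" "y' \<in> slack_polytope a b"
  shows "(\<Sum>i\<in>UNIV. \<gamma> $ i * (y' $ i - y $ i)) = 0"
proof -
  obtain x x' where "y = slack a b x" "y' = slack a b x'"
    using assms by (auto simp: slack_polytope_def)
  then have "(\<Sum>i\<in>UNIV. \<gamma> $ i * (y' $ i - y $ i)) = (\<Sum>i\<in>UNIV. \<gamma> $ i *\<^sub>R a i) \<bullet> (x' - x)"
    by (simp add: slack_def inner_sum_left inner_diff_right right_diff_distrib sum_subtractf)
  then show ?thesis using assms(1) by (simp add: relations_def)
qed

lemma slack_polytope_convex:
  assumes "y \<in> slack_polytope a b" "y' \<in> slack_polytope a b" "0 \<le> t" "t \<le> 1"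
  shows "(1 - t) *\<^sub>R y + t *\<^sub>R y' \<in> slack_polytope a b"
proof -
  obtain x x' where x: "y = slack a b x" "y' = slack a b x'"
    using assms by (auto simp: slack_polytope_def)
  have "(1 - t) *\<^sub>R y + t *\<^sub>R y' = slack a b ((1 - t) *\<^sub>R x + t *\<^sub>R x')"
    by (simp add: x slack_def vec_eq_iff inner_simps algebra_simps)
  moreover have "0 \<le> ((1 - t) *\<^sub>R y + t *\<^sub>R y') $ i" for i
    using assms slack_nonneg[OF assms(1)] slack_nonneg[OF assms(2)] by simp
  ultimately show ?thesis by (auto simp: slack_polytope_def)
qed

text \<open>Coefficients are indexed by \<open>i\<close> and extended by 0 outside \<open>I\<close>,
  so that two expansions can be subtracted to give a relation, even if some \<open>a i\<close>
  coincide.\<close>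

lemma in_convex_cone_hull_imageE:
  fixes a :: "'m::finite \<Rightarrow> 'a::real_vector"
  assumes "x \<in> convex_cone hull (a ` I)"
  obtains c where "\<And>i. 0 \<le> c i" "\<And>i. i \<notin> I \<Longrightarrow> c i = 0" "x = (\<Sum>i\<in>UNIV. c i *\<^sub>R a i)"
proof -
  define S where "S = {x. \<exists>c. (\<forall>i. 0 \<le> c i) \<and> (\<forall>i. i \<notin> I \<longrightarrow> c i = 0) \<and> x = (\<Sum>i\<in>UNIV. c i *\<^sub>R a i)}"
  have "convex_cone hull (a ` I) \<subseteq> S"
  proof (rule hull_minimal)
    show "a ` I \<subseteq> S"
    proof (clarsimp simp: S_def)
      fix i assume "i \<in> I"
      then show "\<exists>c. (\<forall>j. 0 \<le> c j) \<and> (\<forall>j. j \<notin> I \<longrightarrow> c j = (0::real)) \<and> a i = (\<Sum>j\<in>UNIV. c j *\<^sub>R a j)"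
        by (intro exI[of _ "\<lambda>j. if j = i then 1 else 0"]) (auto simp: if_distrib[of "\<lambda>c. c *\<^sub>R _"] cong: if_cong)
    qed
    have "x + y \<in> S" if x: "x \<in> S" and y: "y \<in> S" for x y
    proof -
      obtain c d where "\<forall>i. 0 \<le> c i" "\<forall>i. i \<notin> I \<longrightarrow> c i = 0" "x = (\<Sum>i\<in>UNIV. c i *\<^sub>R a i)"
        "\<forall>i. 0 \<le> d i" "\<forall>i. i \<notin> I \<longrightarrow> d i = 0" "y = (\<Sum>i\<in>UNIV. d i *\<^sub>R a i)"
        using x y unfolding S_def by blast
      then show ?thesis
        unfolding S_def by (intro CollectI exI[of _ "\<lambda>i. c i + d i"]) (auto simp: scaleR_left_distrib sum.distrib)
    qed
    moreover have "t *\<^sub>R x \<in> S" if x: "x \<in> S" and "t \<ge> 0" for x t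
    proof -
      obtain c where "\<forall>i. 0 \<le> c i" "\<forall>i. i \<notin> I \<longrightarrow> c i = 0" "x = (\<Sum>i\<in>UNIV. c i *\<^sub>R a i)"
        using x unfolding S_def by blast
      then show ?thesis
        using \<open>t \<ge> 0\<close> unfolding S_def
        by (intro CollectI exI[of _ "\<lambda>i. t * c i"]) (auto simp: scaleR_sum_right)
    qed
    moreover have "0 \<in> S" unfolding S_def by (intro CollectI exI[of _ "\<lambda>i. 0"]) auto
    ultimately show "convex_cone S" by (auto simp: convex_cone_iff)
  qed
  then show thesis using assms that unfolding S_def by blast
qed

text \<open>Simplicity appears as \<open>no_relation_at_face\<close>: the normals of the facets
  through a common point are linearly independent.\<close>

locale simple_slack_polytope =
  fixes a :: "'m::finite \<Rightarrow> 'a::euclidean_space" and b :: "real ^ 'm"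
  assumes bounded_polytope: "bounded {x. \<forall>i. 0 \<le> slack a b x $ i}"
    and positive_slack: "\<exists>x. \<forall>i. 0 < slack a b x $ i"
    and no_relation_at_face: "\<And>\<gamma> y. \<gamma> \<in> relations a \<Longrightarrow> y \<in> slack_polytope a b \<Longrightarrow>
      (\<And>i. \<gamma> $ i \<noteq> 0 \<Longrightarrow> y $ i = 0) \<Longrightarrow> \<gamma> = 0"
begin

abbreviation H where "H \<equiv> slack_polytope a b"
abbreviation cubes where "cubes \<equiv> cube_complex H"

lemma compact_polytope: "compact {x. \<forall>i. 0 \<le> slack a b x $ i}"
proof -
  have "closed {x. \<forall>i. 0 \<le> slack a b x $ i}"
    unfolding slack_def by (simp, intro closed_Collect_all closed_Collect_le continuous_intros)
  then show ?thesis using bounded_polytope compact_eq_bounded_closed by blast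
qed

lemma compact_H: "compact H"
  unfolding slack_polytope_def
  by (intro compact_continuous_image compact_polytope)
    (auto simp: slack_def intro!: continuous_intros)

lemma positive_point: obtains y where "y \<in> H" "\<And>i. 0 < y $ i"
proof -
  obtain x where "\<And>i. 0 < slack a b x $ i" using positive_slack by blast
  then show thesis using that[of "slack a b x"] by (auto simp: slack_polytope_def less_imp_le)
qed

text \<open>The complex is a finite union of closed faces of the unit cube, one for each index set
  whose facets have a common point.\<close>

lemma compact_cubes: "compact cubes"
proof -
  define \<K> where "\<K> = {S. \<exists>y\<in>H. \<forall>i\<in>S. y $ i = 0}"
  let ?C = "\<lambda>S. cbox 0 1 \<inter> (\<Inter>i\<in>-S. {r :: real ^ 'm. r $ i = 1})"
  have "cubes = (\<Union>S\<in>\<K>. ?C S)"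
  proof (intro equalityI subsetI)
    fix r assume "r \<in> cubes"
    then obtain y where y: "y \<in> H" "\<And>i. r $ i < 1 \<Longrightarrow> y $ i = 0"
      and r: "\<And>i. 0 \<le> r $ i" "\<And>i. r $ i \<le> 1"
      by (auto simp: cube_complex_def)
    have "{i. r $ i < 1} \<in> \<K>" using y by (auto simp: \<K>_def)
    moreover have "r \<in> ?C {i. r $ i < 1}"
      using r by (simp add: mem_box_cart order.antisym not_less)
    ultimately show "r \<in> (\<Union>S\<in>\<K>. ?C S)" by (rule UN_I)
  next
    fix r assume "r \<in> (\<Union>S\<in>\<K>. ?C S)"
    then obtain S where S: "S \<in> \<K>" "r \<in> ?C S" by blast
    obtain y where y: "y \<in> H" "\<And>i. i \<in> S \<Longrightarrow> y $ i = 0"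
      using S(1) by (auto simp: \<K>_def)
    have r: "\<And>i. 0 \<le> r $ i \<and> r $ i \<le> 1" "\<And>i. i \<notin> S \<Longrightarrow> r $ i = 1"
      using S(2) by (auto simp: mem_box_cart)
    have "y $ i = 0" if "r $ i < 1" for i
      using that y(2)[of i] r(2)[of i] by (cases "i \<in> S") auto
    then show "r \<in> cubes"
      using y(1) r(1) unfolding cube_complex_def by blast
  qed
  moreover have "closed {r :: real ^ 'm. r $ i = 1}" for i
    by (intro closed_Collect_eq continuous_on_component continuous_on_id continuous_on_const)
  then have "compact (?C S)" for S
    by (intro compact_Int_closed compact_cbox closed_INT ballI)
  ultimately show ?thesis using compact_UN[of \<K> ?C] by simp
qed

text \<open>This is where the fan structure enters: two cones of the normal fan meet in a common face.
  Pairing the relation with the difference of the two points makes every summand nonnegative.\<close>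

lemma relation_separated_zero:
  assumes \<gamma>: "\<gamma> \<in> relations a" and p: "p \<in> H" and q: "q \<in> H"
    and pos: "\<And>i. 0 < \<gamma> $ i \<Longrightarrow> p $ i = 0" and neg: "\<And>i. \<gamma> $ i < 0 \<Longrightarrow> q $ i = 0"
  shows "\<gamma> = 0"
proof (rule no_relation_at_face[OF \<gamma> p])
  have nonneg: "0 \<le> \<gamma> $ i * (q $ i - p $ i)" for i
    using pos[of i] neg[of i] slack_nonneg[OF p, of i] slack_nonneg[OF q, of i]
    by (cases "\<gamma> $ i" "0::real" rule: linorder_cases) (auto simp: mult_nonpos_nonneg)
  have zero: "\<gamma> $ i * (q $ i - p $ i) = 0" for i
    using relations_orthogonal[OF \<gamma> p q] sum_nonneg_eq_0_iff[of UNIV "\<lambda>i. \<gamma> $ i * (q $ i - p $ i)"] nonneg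
    by simp
  \<comment> \<open>Where \<open>\<gamma> $ i\<close> is negative, \<open>q $ i = 0\<close> and the
    vanishing product give \<open>p $ i = 0\<close> as well, so the whole support of
    \<open>\<gamma>\<close> is tight at \<open>p\<close>.\<close>
  fix i assume "\<gamma> $ i \<noteq> 0"
  then show "p $ i = 0"
    using zero[of i] pos[of i] neg[of i] by (cases "\<gamma> $ i > 0") auto
qed

section \<open>Uniqueness of linked partners\<close>

text \<open>Subtracting the two links leaves the relation 1/r' - 1/r. Where it is positive, r' < r
  <= 1 and \<open>p'\<close> is tight; where it is negative, r < r' <= 1 and \<open>p\<close> is
  tight. So \<open>relation_separated_zero\<close> applies.\<close>

lemma linked_unique_left:
  assumes "r \<in> cubes" "r' \<in> cubes" "y \<in> H" "linked a r y" "linked a r' y"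
  shows "r = r'"
proof -
  obtain p p' where p: "p \<in> H" "\<And>i. r $ i < 1 \<Longrightarrow> p $ i = 0" and p': "p' \<in> H" "\<And>i. r' $ i < 1 \<Longrightarrow> p' $ i = 0"
    and r: "\<And>i. 0 \<le> r $ i" "\<And>i. r $ i \<le> 1" and r': "\<And>i. 0 \<le> r' $ i" "\<And>i. r' $ i \<le> 1"
    using assms unfolding cube_complex_def by auto
  obtain \<gamma> \<gamma>' where \<gamma>: "\<gamma> \<in> relations a" "\<And>i. r $ i - y $ i = \<gamma> $ i * r $ i * y $ i"
    and \<gamma>': "\<gamma>' \<in> relations a" "\<And>i. r' $ i - y $ i = \<gamma>' $ i * r' $ i * y $ i"
    using assms unfolding linked_def by auto
  \<comment> \<open>This is the multiplied-out form of 1/r' - 1/r; if \<open>y $ i = 0\<close>, both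
    \<open>r $ i\<close> and \<open>r' $ i\<close> vanish.\<close>
  have diff: "r $ i - r' $ i = (\<gamma> - \<gamma>') $ i * r $ i * r' $ i" for i
  proof (cases "y $ i = 0")
    case True
    then show ?thesis using \<gamma>(2)[of i] \<gamma>'(2)[of i] by simp
  next
    case False
    have "y $ i * (r $ i - r' $ i) = y $ i * ((\<gamma> - \<gamma>') $ i * r $ i * r' $ i)"
      using \<gamma>(2)[of i] \<gamma>'(2)[of i] by (simp, algebra)
    then show ?thesis using False by simp
  qed
  have small: "r' $ i < 1" if "0 < (\<gamma> - \<gamma>') $ i" for i
  proof (rule ccontr)
    assume "\<not> r' $ i < 1"
    then have 1: "r' $ i = 1" using r'(2)[of i] by simp
    then have "r $ i \<le> 0"
      using diff[of i] r[of i] that by (smt (verit) mult_pos_pos mult.right_neutral)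
    then have "r $ i = 0" using r(1)[of i] by simp
    then show False using diff[of i] 1 by simp
  qed
  have small': "r $ i < 1" if "(\<gamma> - \<gamma>') $ i < 0" for i
  proof (rule ccontr)
    assume "\<not> r $ i < 1"
    then have 1: "r $ i = 1" using r(2)[of i] by simp
    then have "r' $ i \<le> 0"
      using diff[of i] r'[of i] that by (smt (verit) mult_neg_pos mult.right_neutral)
    then have "r' $ i = 0" using r'(1)[of i] by simp
    then show False using diff[of i] 1 by simp
  qed
  have "\<gamma> - \<gamma>' = 0"
    using relation_separated_zero[OF relations_diff[OF \<gamma>(1) \<gamma>'(1)] p'(1) p(1)] p(2) p'(2) small small'
    by blast
  then show ?thesis using diff by (simp add: vec_eq_iff)
qed

text \<open>Here the difference of the relations is 1/y' - 1/y. Its pairing with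
  \<open>y - y'\<close> is zero by orthogonality, yet every summand is a square times a nonnegative
  product.\<close>

lemma linked_unique_right:
  assumes "y \<in> H" "y' \<in> H" "linked a r y" "linked a r y'"
  shows "y = y'"
proof -
  obtain \<gamma> \<gamma>' where \<gamma>: "\<gamma> \<in> relations a" "\<And>i. r $ i - y $ i = \<gamma> $ i * r $ i * y $ i"
    and \<gamma>': "\<gamma>' \<in> relations a" "\<And>i. r $ i - y' $ i = \<gamma>' $ i * r $ i * y' $ i"
    using assms unfolding linked_def by auto
  have diff: "y $ i - y' $ i = (\<gamma>' - \<gamma>) $ i * y $ i * y' $ i" for i
  proof (cases "r $ i = 0")
    case True
    then show ?thesis using \<gamma>(2)[of i] \<gamma>'(2)[of i] by simp
  next
    case False
    have "r $ i * (y $ i - y' $ i) = r $ i * ((\<gamma>' - \<gamma>) $ i * y $ i * y' $ i)"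
      using \<gamma>(2)[of i] \<gamma>'(2)[of i] by (simp, algebra)
    then show ?thesis using False by simp
  qed
  have eq: "(\<gamma>' - \<gamma>) $ i * (y $ i - y' $ i) = ((\<gamma>' - \<gamma>) $ i)\<^sup>2 * (y $ i * y' $ i)" for i
    by (subst diff) (simp add: power2_eq_square)
  have "(\<Sum>i\<in>UNIV. ((\<gamma>' - \<gamma>) $ i)\<^sup>2 * (y $ i * y' $ i)) = 0"
    using relations_orthogonal[OF relations_diff[OF \<gamma>'(1) \<gamma>(1)] assms(2,1)] eq by simp
  then have "((\<gamma>' - \<gamma>) $ i)\<^sup>2 * (y $ i * y' $ i) = 0" for i
    using slack_nonneg[OF assms(1)] slack_nonneg[OF assms(2)]
    by (subst (asm) sum_nonneg_eq_0_iff) auto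
  then show ?thesis
    using diff by (simp add: vec_eq_iff) (metis mult_eq_0_iff right_minus_eq)
qed

text \<open>The function \<open>\<phi>\<close> below is homogeneous, and by \<open>relation_separated_zero\<close> it is positive on the
  compact unit sphere of the space of relations.\<close>

lemma relations_bounded:
  assumes p: "p \<in> H" and q: "q \<in> H" and "0 \<le> c"
  obtains B where "\<And>\<gamma>. \<gamma> \<in> relations a \<Longrightarrow> (\<And>i. p $ i \<noteq> 0 \<Longrightarrow> \<gamma> $ i \<le> c) \<Longrightarrow>
    (\<And>i. q $ i \<noteq> 0 \<Longrightarrow> - c \<le> \<gamma> $ i) \<Longrightarrow> norm \<gamma> \<le> B"
proof -
  \<comment> \<open>\<open>\<phi>\<close> measures how far the signs of \<open>\<gamma>\<close>
    violate the hypotheses of \<open>relation_separated_zero\<close> at \<open>p\<close> and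
    \<open>q\<close>.\<close>
  define \<phi> where "\<phi> = (\<lambda>\<gamma> :: real ^ 'm. \<Sum>i\<in>UNIV.
    (if p $ i = 0 then 0 else max 0 (\<gamma> $ i)) + (if q $ i = 0 then 0 else max 0 (- \<gamma> $ i)))"
  define U where "U = relations a \<inter> sphere 0 1"
  have nonneg: "0 \<le> \<phi> \<gamma>" for \<gamma>
    unfolding \<phi>_def by (intro sum_nonneg) auto
  have pos: "0 < \<phi> \<gamma>" if "\<gamma> \<in> U" for \<gamma>
  proof (rule ccontr)
    assume "\<not> 0 < \<phi> \<gamma>"
    then have "\<phi> \<gamma> = 0" using nonneg[of \<gamma>] by simp
    then have "\<forall>i. (if p $ i = 0 then 0 else max 0 (\<gamma> $ i)) + (if q $ i = 0 then 0 else max 0 (- \<gamma> $ i)) = 0"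
      unfolding \<phi>_def by (subst (asm) sum_nonneg_eq_0_iff) auto
    then have "0 < \<gamma> $ i \<Longrightarrow> p $ i = 0" "\<gamma> $ i < 0 \<Longrightarrow> q $ i = 0" for i
      by (smt (verit, best))+
    then have "\<gamma> = 0"
      using relation_separated_zero[OF _ p q] that by (auto simp: U_def)
    then show False using that by (simp add: U_def)
  qed
  have "continuous_on U \<phi>"
  proof -
    have "continuous_on U (\<lambda>\<gamma>. if p $ i = 0 then 0 else max 0 (\<gamma> $ i))"
      "continuous_on U (\<lambda>\<gamma>. if q $ i = 0 then 0 else max 0 (- \<gamma> $ i))" for i
      by (cases "p $ i = 0"; auto intro!: continuous_intros)
        (cases "q $ i = 0"; auto intro!: continuous_intros)
    then show ?thesis unfolding \<phi>_def by (intro continuous_on_sum continuous_on_add)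
  qed
  moreover have "compact U"
    unfolding U_def by (simp add: closed_relations closed_Int_compact)
  ultimately obtain d where d: "0 < d" "\<And>\<gamma>. \<gamma> \<in> U \<Longrightarrow> d \<le> \<phi> \<gamma>"
  proof (cases "U = {}")
    case False
    then show ?thesis
      using continuous_attains_inf[OF \<open>compact U\<close> False \<open>continuous_on U \<phi>\<close>] pos that by metis
  \<comment> \<open>If there is no nonzero relation, \<open>U\<close> is empty and any positive
    \<open>d\<close> will do.\<close>
  qed (use that[of 1] in auto)
  have hom: "\<phi> (t *\<^sub>R \<gamma>) = t * \<phi> \<gamma>" if "0 \<le> t" for t \<gamma>
    using that unfolding \<phi>_def sum_distrib_left
    by (intro sum.cong refl) (auto simp: max_mult_distrib_left algebra_simps)
  \<comment> \<open>Each coordinate contributes at most \<open>2 * c\<close> to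
    \<open>\<phi>\<close>, while homogeneity bounds \<open>\<phi>\<close> below by \<open>d\<close>
    times the norm.\<close>
  have "norm \<gamma> \<le> 2 * c * CARD('m) / d"
    if \<gamma>: "\<gamma> \<in> relations a" and up: "\<And>i. p $ i \<noteq> 0 \<Longrightarrow> \<gamma> $ i \<le> c"
      and lo: "\<And>i. q $ i \<noteq> 0 \<Longrightarrow> - c \<le> \<gamma> $ i" for \<gamma>
  proof (cases "\<gamma> = 0")
    case False
    then have "(1 / norm \<gamma>) *\<^sub>R \<gamma> \<in> U"
      using relations_scaleR[OF \<gamma>] by (simp add: U_def)
    then have "d * norm \<gamma> \<le> \<phi> \<gamma>"
      using d(2)[of "(1 / norm \<gamma>) *\<^sub>R \<gamma>"] hom[of "1 / norm \<gamma>" \<gamma>] False by (simp add: field_simps)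
    also have "\<phi> \<gamma> \<le> (\<Sum>i\<in>(UNIV :: 'm set). 2 * c)"
    proof (unfold \<phi>_def, rule sum_mono)
      fix i
      show "(if p $ i = 0 then 0 else max 0 (\<gamma> $ i)) + (if q $ i = 0 then 0 else max 0 (- \<gamma> $ i)) \<le> 2 * c"
        using up[of i] lo[of i] \<open>0 \<le> c\<close> by auto
    qed
    finally show ?thesis using d(1) by (simp add: field_simps)
  qed (use \<open>0 \<le> c\<close> d in simp)
  then show thesis using that by blast
qed

section \<open>Limits of linked pairs and existence of partners\<close>

text \<open>The terms 1/y bound the relations above where \<open>y'\<close> is positive, and the
  terms 1/r bound them below where the witness \<open>q\<close> of \<open>r'\<close> is positive,
  since there \<open>r'\<close> equals 1. Then \<open>relations_bounded\<close> yields a convergent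
  subsequence, along which the link passes to the limit.\<close>

lemma linked_limit:
  assumes r: "r \<longlonglongrightarrow> r'" and y: "y \<longlonglongrightarrow> y'" and r': "r' \<in> cubes" and y': "y' \<in> H"
    and nonneg: "\<And>k i. 0 \<le> r k $ i" "\<And>k i. 0 \<le> y k $ i"
    and link: "\<And>k. linked a (r k) (y k)"
  shows "linked a r' y'"
proof -
  obtain \<gamma> where \<gamma>: "\<And>k. \<gamma> k \<in> relations a" "\<And>k i. r k $ i - y k $ i = \<gamma> k $ i * r k $ i * y k $ i"
    using link unfolding linked_def by metis
  obtain q where q: "q \<in> H" "\<And>i. r' $ i < 1 \<Longrightarrow> q $ i = 0" and r'le: "\<And>i. r' $ i \<le> 1"
    using r' unfolding cube_complex_def by auto
  \<comment> \<open>The factors 2 leave room around the limits: eventually y > y'/2, and r > 1/2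
    where r' = 1. Coordinates with \<open>y' $ i = 0\<close> contribute 2/0 = 0.\<close>
  define c where "c = 2 + (\<Sum>i\<in>UNIV. 2 / y' $ i)"
  have c: "2 \<le> c" "2 / y' $ i \<le> c" for i
  proof -
    have *: "0 \<le> 2 / y' $ j" for j using slack_nonneg[OF y'] by simp
    show "2 \<le> c" unfolding c_def using * by (simp add: sum_nonneg)
    have "2 / y' $ i \<le> (\<Sum>i\<in>UNIV. 2 / y' $ i)" using * by (intro member_le_sum) auto
    then show "2 / y' $ i \<le> c" by (simp add: c_def)
  qed
  have \<gamma>_eq: "\<gamma> k $ i = 1 / y k $ i - 1 / r k $ i" if "r k $ i \<noteq> 0" for k i
    using \<gamma>(2)[of k i] that by (cases "y k $ i = 0") (auto simp: field_simps)
  have up: "\<forall>\<^sub>F k in sequentially. y' $ i \<noteq> 0 \<longrightarrow> \<gamma> k $ i \<le> c" for i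
  proof (cases "y' $ i = 0")
    case False
    then have pos: "0 < y' $ i" using slack_nonneg[OF y', of i] by simp
    have "(\<lambda>k. y k $ i) \<longlonglongrightarrow> y' $ i" using y by (rule tendsto_vec_nth)
    then have "\<forall>\<^sub>F k in sequentially. y' $ i / 2 < y k $ i"
      using pos by (intro order_tendstoD(1)) auto
    then show ?thesis
    proof eventually_elim
      case (elim k)
      then have "y k $ i > 0" using pos by simp
      then have rk: "r k $ i \<noteq> 0" using linked_zero_iff[OF link] by simp
      have "1 / y k $ i \<le> 2 / y' $ i"
        using elim pos \<open>y k $ i > 0\<close> by (simp add: field_simps)
      then have "\<gamma> k $ i \<le> 2 / y' $ i"
        using \<gamma>_eq[OF rk] nonneg(1)[of k i] by (smt (verit) divide_nonneg_nonneg)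
      then show ?case using c(2)[of i] by simp
    qed
  qed simp
  have lo: "\<forall>\<^sub>F k in sequentially. q $ i \<noteq> 0 \<longrightarrow> - c \<le> \<gamma> k $ i" for i
  proof (cases "q $ i = 0")
    case False
    then have 1: "r' $ i = 1" using q(2)[of i] r'le[of i] by force
    have "(\<lambda>k. r k $ i) \<longlonglongrightarrow> r' $ i" using r by (rule tendsto_vec_nth)
    then have "\<forall>\<^sub>F k in sequentially. 1 / 2 < r k $ i"
      using 1 by (intro order_tendstoD(1)) auto
    then show ?thesis
    proof eventually_elim
      case (elim k)
      then have "1 / r k $ i \<le> 2" by (simp add: field_simps)
      moreover have "0 \<le> 1 / y k $ i" using nonneg by simp
      moreover have rk: "r k $ i \<noteq> 0" using elim by auto
      ultimately show ?case using \<gamma>_eq[of k i] elim c(1) rk by linarith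
    qed
  qed simp
  obtain B where B: "\<And>\<gamma>. \<gamma> \<in> relations a \<Longrightarrow> (\<And>i. y' $ i \<noteq> 0 \<Longrightarrow> \<gamma> $ i \<le> c) \<Longrightarrow>
    (\<And>i. q $ i \<noteq> 0 \<Longrightarrow> - c \<le> \<gamma> $ i) \<Longrightarrow> norm \<gamma> \<le> B"
    using relations_bounded[OF y' q(1), of c] c(1) by auto
  have "\<forall>\<^sub>F k in sequentially. \<forall>i. (y' $ i \<noteq> 0 \<longrightarrow> \<gamma> k $ i \<le> c) \<and> (q $ i \<noteq> 0 \<longrightarrow> - c \<le> \<gamma> k $ i)"
    using up lo by (intro eventually_all_finite eventually_conj)
  then obtain N where "\<And>k. k \<ge> N \<Longrightarrow> norm (\<gamma> k) \<le> B"
    unfolding eventually_sequentially using B \<gamma>(1) by metis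
  then have "\<forall>k. \<gamma> (k + N) \<in> relations a \<inter> cball 0 B"
    using \<gamma>(1) by simp
  moreover have "seq_compact (relations a \<inter> cball 0 B)"
    by (simp add: closed_relations closed_Int_compact compact_imp_seq_compact)
  ultimately obtain \<gamma>' s where \<gamma>': "\<gamma>' \<in> relations a" and s: "strict_mono s"
    and lim: "((\<lambda>k. \<gamma> (k + N)) \<circ> s) \<longlonglongrightarrow> \<gamma>'"
    using seq_compactE[of _ "\<lambda>k. \<gamma> (k + N)"] by (metis IntE)
  have rs: "((\<lambda>k. r (k + N)) \<circ> s) \<longlonglongrightarrow> r'" and ys: "((\<lambda>k. y (k + N)) \<circ> s) \<longlonglongrightarrow> y'"
    using s r y by (auto intro!: LIMSEQ_subseq_LIMSEQ LIMSEQ_ignore_initial_segment)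
  have "r' $ i - y' $ i = \<gamma>' $ i * r' $ i * y' $ i" for i
  proof (rule LIMSEQ_unique)
    show "(\<lambda>k. r (s k + N) $ i - y (s k + N) $ i) \<longlonglongrightarrow> r' $ i - y' $ i"
      using rs ys by (intro tendsto_diff tendsto_vec_nth) (simp_all add: o_def)
    show "(\<lambda>k. r (s k + N) $ i - y (s k + N) $ i) \<longlonglongrightarrow> \<gamma>' $ i * r' $ i * y' $ i"
      unfolding \<gamma>(2) using rs ys lim by (intro tendsto_mult tendsto_vec_nth) (simp_all add: o_def)
  qed
  then show ?thesis using \<gamma>' unfolding linked_def by blast
qed

text \<open>Here the link is the critical point equation of a logarithmic barrier function; the product
  vanishes on the boundary, so its maximum lies in the interior.\<close>

lemma exists_linked_right:
  assumes "\<And>i. 0 < r $ i"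
  obtains y where "y \<in> H" "linked a r y"
proof -
  \<comment> \<open>This is the exponential of the barrier, which extends continuously to the
    boundary where the logarithm is undefined.\<close>
  define F where "F = (\<lambda>y :: real ^ 'm. \<Prod>i\<in>UNIV. y $ i * exp (- y $ i / r $ i))"
  have "continuous_on H F"
    using assms unfolding F_def
    by (intro continuous_intros) (simp add: less_imp_neq[symmetric])
  moreover obtain y0 where y0: "y0 \<in> H" "\<And>i. 0 < y0 $ i" using positive_point by blast
  ultimately obtain y where y: "y \<in> H" and max: "\<And>y'. y' \<in> H \<Longrightarrow> F y' \<le> F y"
    using continuous_attains_sup[OF compact_H] by blast
  have "0 < F y0" unfolding F_def using y0 by (intro prod_pos) auto
  then have "0 < F y" using max[OF y0(1)] by simp
  then have "y $ i \<noteq> 0" for i unfolding F_def by (metis UNIV_I finite less_irrefl mult_zero_left prod_zero)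
  then have ypos: "0 < y $ i" for i using slack_nonneg[OF y, of i] by (simp add: less_le)
  obtain x where x: "y = slack a b x" using y by (auto simp: slack_polytope_def)
  define \<gamma> :: "real ^ 'm" where "\<gamma> = (\<chi> i. 1 / y $ i - 1 / r $ i)"
  have "(\<Sum>i\<in>UNIV. \<gamma> $ i *\<^sub>R a i) \<bullet> u = 0" for u
  proof -
    define d where "d i = a i \<bullet> u" for i
    \<comment> \<open>\<open>G\<close> is the logarithm of \<open>F\<close> along the line in
      direction \<open>u\<close>. Its derivative at the maximum is the pairing of the sum of the
      \<open>\<gamma> $ i *\<^sub>R a i\<close> with \<open>u\<close>.\<close>
    define G where "G t = (\<Sum>i\<in>UNIV. ln (y $ i + t * d i) - (y $ i + t * d i) / r $ i)" for t
    have "\<forall>\<^sub>F t in nhds 0. \<forall>i. 0 < y $ i + t * d i"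
    proof (intro eventually_all_finite)
      fix i
      have "((\<lambda>t. y $ i + t * d i) \<longlongrightarrow> y $ i + 0 * d i) (nhds 0)" by (intro tendsto_intros filterlim_ident)
      then show "\<forall>\<^sub>F t in nhds 0. 0 < y $ i + t * d i" by (rule order_tendstoD) (simp add: ypos)
    qed
    then obtain e where e: "0 < e" "\<And>t i. \<bar>t\<bar> < e \<Longrightarrow> 0 < y $ i + t * d i"
      unfolding eventually_nhds_metric by (auto simp: dist_real_def)
    have G: "exp (G t) \<le> F y \<and> (t = 0 \<longrightarrow> exp (G t) = F y)" if "\<bar>t\<bar> < e" for t
    proof -
      define y' where "y' = slack a b (x + t *\<^sub>R u)"
      have y': "y' $ i = y $ i + t * d i" for i by (simp add: y'_def slack_add_scaleR x d_def)
      have pos: "0 < y' $ i" for i using e(2)[OF that] y' by simp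
      then have "y' \<in> H" by (auto simp: slack_polytope_def y'_def intro: less_imp_le)
      moreover have "exp (G t) = F y'"
        unfolding G_def F_def y'[symmetric] using pos
        by (simp add: exp_sum exp_diff exp_minus field_simps)
      moreover have "y' = y" if "t = 0" using y' that by (simp add: vec_eq_iff)
      ultimately show ?thesis using max by auto
    qed
    have "G t \<le> G 0" if "\<bar>t\<bar> < e" for t
    proof -
      have "exp (G t) \<le> exp (G 0)" using G[OF that] G[of 0] e(1) by auto
      then show ?thesis by simp
    qed
    moreover have "((\<lambda>t. ln (y $ i + t * d i) - (y $ i + t * d i) / r $ i)
        has_real_derivative d i / y $ i - d i / r $ i) (at 0)" for i
      using ypos[of i] assms[of i] by (auto intro!: derivative_eq_intros)
    then have "(G has_real_derivative (\<Sum>i\<in>UNIV. d i / y $ i - d i / r $ i)) (at 0)"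
      unfolding G_def by (rule DERIV_sum)
    ultimately have "(\<Sum>i\<in>UNIV. d i / y $ i - d i / r $ i) = 0"
      using e(1) by (intro DERIV_local_max[of G _ 0 e]) auto
    then show ?thesis by (simp add: \<gamma>_def inner_sum_left d_def left_diff_distrib)
  qed
  then have "\<gamma> \<in> relations a"
    using inner_eq_zero_iff unfolding relations_def by blast
  moreover have "r $ i - y $ i = \<gamma> $ i * r $ i * y $ i" for i
    using ypos[of i] assms[of i] by (simp add: \<gamma>_def field_simps)
  ultimately show thesis using that[OF y] unfolding linked_def by blast
qed

text \<open>Completeness of the normal fan: a linear functional attains its minimum over the polytope at
  a point whose normal cone contains it.\<close>

lemma normal_fan_complete:
  obtains y c where "y \<in> H" "\<And>i. 0 \<le> c i" "\<And>i. y $ i \<noteq> 0 \<Longrightarrow> c i = 0" "w = (\<Sum>i\<in>UNIV. c i *\<^sub>R a i)"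
proof -
  define P where "P = {x. \<forall>i. 0 \<le> slack a b x $ i}"
  have "P \<noteq> {}" using positive_slack unfolding P_def by (force intro: less_imp_le)
  then obtain p where p: "p \<in> P" and min: "\<And>x. x \<in> P \<Longrightarrow> w \<bullet> p \<le> w \<bullet> x"
    using continuous_attains_inf[of P "\<lambda>x. w \<bullet> x"] compact_polytope
    by (auto simp: P_def continuous_on_inner)
  define I where "I = {i. slack a b p $ i = 0}"
  \<comment> \<open>Otherwise a separating vector \<open>u\<close> would point from \<open>p\<close>
    into the polytope while \<open>w\<close> decreases along it, against minimality at
    \<open>p\<close>.\<close>
  have "w \<in> convex_cone hull (a ` I)"
  proof (rule ccontr)
    let ?K = "convex_cone hull (a ` I)"
    assume "w \<notin> ?K"
    then obtain u \<beta> where u: "u \<bullet> w < \<beta>" "\<And>x. x \<in> ?K \<Longrightarrow> \<beta> < u \<bullet> x"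
      using separating_hyperplane_closed_point[OF convex_convex_cone_hull closed_convex_cone_hull]
      by (metis finite finite_imageI)
    have "\<beta> < 0" using u(2)[OF convex_cone_hull_contains_0] by simp
    have edge: "0 \<le> a i \<bullet> u" if "i \<in> I" for i
    proof (rule ccontr)
      assume neg: "\<not> 0 \<le> a i \<bullet> u"
      \<comment> \<open>This nonnegative multiple of \<open>a i\<close> pairs with \<open>u\<close>
        to exactly \<open>\<beta>\<close>, contradicting strict separation.\<close>
      have "(\<beta> / (a i \<bullet> u)) *\<^sub>R a i \<in> ?K"
        using that neg \<open>\<beta> < 0\<close> by (intro convex_cone_hull_mul hull_inc) (auto intro: divide_nonpos_nonpos)
      from u(2)[OF this] neg show False by (simp add: inner_commute)
    qed
    have "\<forall>\<^sub>F t in at_right 0. 0 \<le> slack a b p $ i + t * (a i \<bullet> u)" for i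
    proof (cases "i \<in> I")
      case True
      have "\<forall>\<^sub>F t in at_right (0::real). 0 < t" by (rule eventually_at_right_less)
      then show ?thesis
        by eventually_elim (use True edge[of i] in \<open>simp add: I_def\<close>)
    next
      case False
      then have "0 < slack a b p $ i" using p by (auto simp: P_def I_def less_le)
      moreover have "((\<lambda>t. slack a b p $ i + t * (a i \<bullet> u)) \<longlongrightarrow> slack a b p $ i + 0 * (a i \<bullet> u)) (at_right 0)"
        by (intro tendsto_intros)
      ultimately have "\<forall>\<^sub>F t in at_right 0. 0 < slack a b p $ i + t * (a i \<bullet> u)"
        by (intro order_tendstoD) auto
      then show ?thesis by eventually_elim simp
    qed
    then have "\<forall>\<^sub>F t in at_right 0. \<forall>i. 0 \<le> slack a b p $ i + t * (a i \<bullet> u)"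
      by (rule eventually_all_finite)
    then have "\<forall>\<^sub>F t in at_right 0. 0 < t \<and> (\<forall>i. 0 \<le> slack a b p $ i + t * (a i \<bullet> u))"
      by (intro eventually_conj eventually_at_right_less)
    then obtain t where t: "0 < t" "\<And>i. 0 \<le> slack a b p $ i + t * (a i \<bullet> u)"
      by (auto dest!: eventually_happens)
    then have "w \<bullet> p \<le> w \<bullet> (p + t *\<^sub>R u)" by (intro min) (simp add: P_def slack_add_scaleR)
    then have "0 \<le> t * (u \<bullet> w)" by (simp add: inner_simps inner_commute)
    then show False using u(1) \<open>\<beta> < 0\<close> t(1) by (simp add: zero_le_mult_iff)
  qed
  then obtain c where "\<And>i. 0 \<le> c i" "\<And>i. i \<notin> I \<Longrightarrow> c i = 0" "w = (\<Sum>i\<in>UNIV. c i *\<^sub>R a i)"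
    using in_convex_cone_hull_imageE by blast
  moreover have "slack a b p \<in> H" using p by (auto simp: P_def slack_polytope_def)
  ultimately show thesis using that[of "slack a b p" c] by (auto simp: I_def)
qed

text \<open>Setting 1/r = 1 + c turns the link into an expansion of the sum of (1/y - 1) a over
  tight normals; \<open>c i \<ge> 0\<close> gives \<open>r $ i \<le> 1\<close>, with equality off
  the tight facets.\<close>

lemma exists_linked_left:
  assumes "\<And>i. 0 < y $ i"
  obtains r where "r \<in> cubes" "linked a r y"
proof -
  obtain p c where p: "p \<in> H" and c: "\<And>i. 0 \<le> c i" "\<And>i. p $ i \<noteq> 0 \<Longrightarrow> c i = 0"
    and w: "(\<Sum>i\<in>UNIV. (1 / y $ i - 1) *\<^sub>R a i) = (\<Sum>i\<in>UNIV. c i *\<^sub>R a i)"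
    using normal_fan_complete[of "\<Sum>i\<in>UNIV. (1 / y $ i - 1) *\<^sub>R a i"] by blast
  define r :: "real ^ 'm" where "r = (\<chi> i. 1 / (1 + c i))"
  define \<gamma> :: "real ^ 'm" where "\<gamma> = (\<chi> i. 1 / y $ i - 1 - c i)"
  have c1: "0 < 1 + c i" for i using c(1)[of i] by simp
  have "r \<in> cubes"
  proof -
    have "p $ i = 0" if "r $ i < 1" for i
      using that c(2)[of i] by (cases "p $ i = 0") (auto simp: r_def)
    then show ?thesis
      unfolding cube_complex_def using p c(1) c1 by (auto simp: r_def field_simps)
  qed
  moreover have "\<gamma> \<in> relations a"
    using w by (simp add: relations_def \<gamma>_def scaleR_left_diff_distrib sum_subtractf)
  moreover have "r $ i - y $ i = \<gamma> $ i * r $ i * y $ i" for i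
  proof -
    have "\<gamma> $ i * r $ i * y $ i = (1 / y $ i * y $ i) * r $ i - ((1 + c i) * r $ i) * y $ i"
      by (simp add: \<gamma>_def algebra_simps del: times_divide_eq_left)
    then show ?thesis using assms[of i] c1[of i] by (simp add: r_def)
  qed
  ultimately show thesis using that unfolding linked_def by blast
qed

section \<open>The compact graph of the link\<close>

definition graph :: "((real ^ 'm) \<times> (real ^ 'm)) set" where
  "graph = {(r, y). r \<in> cubes \<and> y \<in> H \<and> linked a r y}"

text \<open>By \<open>linked_limit\<close> the graph is closed in the compact product
  \<open>cubes \<times> H\<close>.\<close>

lemma compact_graph: "compact graph"
proof -
  have "closed graph"
    unfolding closed_sequential_limits
  proof (intro allI impI, elim conjE)
    fix x l assume x: "\<forall>n. x n \<in> graph" and "x \<longlonglongrightarrow> l"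
    then have lim: "(\<lambda>n. fst (x n)) \<longlonglongrightarrow> fst l" "(\<lambda>n. snd (x n)) \<longlonglongrightarrow> snd l"
      by (auto intro: tendsto_fst tendsto_snd)
    have gr: "fst (x n) \<in> cubes" "snd (x n) \<in> H" "linked a (fst (x n)) (snd (x n))" for n
      using x by (auto simp: graph_def case_prod_beta)
    have "fst l \<in> cubes" "snd l \<in> H"
      using closed_sequentially[OF compact_imp_closed[OF compact_cubes] gr(1) lim(1)]
        closed_sequentially[OF compact_imp_closed[OF compact_H] gr(2) lim(2)] .
    moreover from this have "linked a (fst l) (snd l)"
      using gr slack_nonneg[OF gr(2)]
      by (intro linked_limit[OF lim]) (auto simp: cube_complex_def)
    ultimately show "l \<in> graph" by (auto simp: graph_def case_prod_beta)
  qed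
  moreover have "graph \<subseteq> cubes \<times> H" by (auto simp: graph_def)
  ultimately show ?thesis
    using compact_Times[OF compact_cubes compact_H]
    by (metis compact_Int_closed inf.absorb_iff2)
qed

lemma fst_graph: "fst ` graph = cubes"
proof (intro equalityI subsetI)
  fix r assume r: "r \<in> cubes"
  \<comment> \<open>Raising coordinates to at least 1/(k+1) stays in the complex, because it can
    only shrink the set of coordinates below 1. Closedness of the projection then reaches
    \<open>r\<close>.\<close>
  define R :: "nat \<Rightarrow> real ^ 'm" where "R k = (\<chi> i. max (r $ i) (inverse (real (Suc k))))" for k
  have "R k \<in> fst ` graph" for k
  proof -
    have "0 < R k $ i" for i unfolding R_def by (simp add: less_max_iff_disj)
    then obtain y where "y \<in> H" "linked a (R k) y" using exists_linked_right by blast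
    moreover have "R k \<in> cubes"
      using r unfolding cube_complex_def R_def by (auto simp: inverse_le_1_iff le_max_iff_disj)
    ultimately show ?thesis by (force simp: graph_def)
  qed
  moreover have "R \<longlonglongrightarrow> r"
  proof (rule vec_tendstoI)
    fix i
    have "(\<lambda>k. max (r $ i) (inverse (real (Suc k)))) \<longlonglongrightarrow> max (r $ i) 0"
      by (intro tendsto_intros LIMSEQ_inverse_real_of_nat)
    then show "(\<lambda>k. R k $ i) \<longlonglongrightarrow> r $ i"
      using r by (simp add: R_def cube_complex_def max_absorb1)
  qed
  moreover have "closed (fst ` graph)"
    by (intro compact_imp_closed compact_continuous_image compact_graph continuous_on_fst continuous_on_id)
  ultimately show "r \<in> fst ` graph" using closed_sequentially by blast 
qed (auto simp: graph_def)

lemma snd_graph: "snd ` graph = H"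
proof (intro equalityI subsetI)
  fix y assume y: "y \<in> H"
  obtain y0 where y0: "y0 \<in> H" "\<And>i. 0 < y0 $ i" using positive_point by blast
  define t where "t k = inverse (real (Suc k))" for k
  have t: "0 < t k" "t k \<le> 1" for k by (auto simp: t_def inverse_le_1_iff)
  \<comment> \<open>Moving towards the interior point \<open>y0\<close> makes all slacks positive,
    so \<open>exists_linked_left\<close> applies.\<close>
  define Y where "Y k = (1 - t k) *\<^sub>R y + t k *\<^sub>R y0" for k
  have "Y k \<in> snd ` graph" for k
  proof -
    have "Y k \<in> H" unfolding Y_def using y y0 t[of k] by (intro slack_polytope_convex) auto
    moreover have "0 < Y k $ i" for i
      unfolding Y_def using y0(2)[of i] slack_nonneg[OF y, of i] t[of k] by (simp add: add_nonneg_pos)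
    then obtain r where "r \<in> cubes" "linked a r (Y k)" using exists_linked_left by blast
    ultimately show ?thesis by (force simp: graph_def)
  qed
  moreover have "Y \<longlonglongrightarrow> y"
  proof -
    have "Y \<longlonglongrightarrow> (1 - 0) *\<^sub>R y + 0 *\<^sub>R y0"
      unfolding Y_def t_def by (intro tendsto_intros LIMSEQ_inverse_real_of_nat)
    then show ?thesis by simp
  qed
  moreover have "closed (snd ` graph)"
    by (intro compact_imp_closed compact_continuous_image compact_graph continuous_on_snd continuous_on_id)
  ultimately show "y \<in> snd ` graph" using closed_sequentially by blast
qed (auto simp: graph_def)

text \<open>By the two uniqueness lemmas both projections are continuous injections of the compact
  graph, hence homeomorphisms onto their images; the map goes through the graph.\<close>

lemma cubes_homeomorphism:
  obtains f g where "homeomorphism cubes H f g" "\<And>r i. r \<in> cubes \<Longrightarrow> f r $ i = 0 \<longleftrightarrow> r $ i = 0"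
proof -
  have "\<exists>g. homeomorphism graph (fst ` graph) fst g"
    by (rule homeomorphism_compact[OF compact_graph])
      (auto intro!: continuous_intros inj_onI dest: linked_unique_right simp: graph_def)
  then obtain \<phi> where \<phi>: "homeomorphism graph cubes fst \<phi>" by (auto simp: fst_graph)
  have "\<exists>g. homeomorphism graph (snd ` graph) snd g"
    by (rule homeomorphism_compact[OF compact_graph])
      (auto intro!: continuous_intros inj_onI dest: linked_unique_left simp: graph_def)
  then obtain \<psi> where \<psi>: "homeomorphism graph H snd \<psi>" by (auto simp: snd_graph)
  have "homeomorphism cubes H (snd \<circ> \<phi>) (fst \<circ> \<psi>)"
    using homeomorphism_compose[OF homeomorphism_symD[OF \<phi>] \<psi>] .
  moreover have "(snd \<circ> \<phi>) r $ i = 0 \<longleftrightarrow> r $ i = 0" if "r \<in> cubes" for r i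
  proof -
    have "\<phi> r \<in> graph" "fst (\<phi> r) = r"
      using \<phi> that by (auto simp: homeomorphism_def)
    then have "linked a r (snd (\<phi> r))" by (auto simp: graph_def)
    then show ?thesis using linked_zero_iff by (simp add: o_def) blast
  qed
  ultimately show thesis by (rule that)
qed

end

section \<open>Lifting along the squared moduli\<close>

definition sq :: "complex ^ 'm \<Rightarrow> real ^ 'm" where
  "sq z = (\<chi> i. (cmod (z $ i))\<^sup>2)"

text \<open>The phase of each coordinate is kept and only its modulus changes;
  \<open>sgn 0 = 0\<close> sends zero coordinates to zero.\<close>

definition lift_moduli :: "(real ^ 'm \<Rightarrow> real ^ 'm) \<Rightarrow> complex ^ 'm \<Rightarrow> complex ^ 'm" where
  "lift_moduli f z = (\<chi> i. sgn (z $ i) * complex_of_real (sqrt (f (sq z) $ i)))"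

lemma sq_torus_act: "t \<in> torus \<Longrightarrow> sq (torus_act t z) = sq z"
  by (simp add: sq_def torus_act_def torus_def norm_mult)

text \<open>The phase is discontinuous only at \<open>z $ i = 0\<close>, where \<open>zero\<close>
  forces the new modulus to tend to 0.\<close>

lemma continuous_on_lift_moduli:
  fixes f :: "real ^ 'm::finite \<Rightarrow> real ^ 'm"
  assumes cont: "continuous_on A f" and zero: "\<And>r i. r \<in> A \<Longrightarrow> r $ i = 0 \<Longrightarrow> f r $ i = 0"
  shows "continuous_on (sq -` A) (lift_moduli f)"
  unfolding continuous_on_def
proof (intro ballI vec_tendstoI)
  fix z i assume z: "z \<in> sq -` A"
  let ?F = "at z within sq -` A"
  have "continuous_on (sq -` A) sq"
    unfolding sq_def by (intro continuous_intros)
  then have "continuous_on (sq -` A) (f \<circ> sq)"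
    by (intro continuous_on_compose) (auto intro: continuous_on_subset[OF cont])
  then have "((\<lambda>z. f (sq z)) \<longlongrightarrow> f (sq z)) ?F"
    using z unfolding continuous_on_def o_def by blast
  then have "((\<lambda>z. f (sq z) $ i) \<longlongrightarrow> f (sq z) $ i) ?F"
    by (rule tendsto_vec_nth)
  then have sqrt: "((\<lambda>z. complex_of_real (sqrt (f (sq z) $ i))) \<longlongrightarrow> complex_of_real (sqrt (f (sq z) $ i))) ?F"
    by (intro tendsto_of_real tendsto_real_sqrt)
  show "((\<lambda>z. lift_moduli f z $ i) \<longlongrightarrow> lift_moduli f z $ i) ?F"
  proof (cases "z $ i = 0")
    case False
    have "((\<lambda>z. sgn (z $ i)) \<longlongrightarrow> sgn (z $ i)) ?F"
      using False by (intro tendsto_intros)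
    then show ?thesis unfolding lift_moduli_def using sqrt by (simp add: tendsto_mult)
  next
    case True
    then have "((\<lambda>z. complex_of_real (sqrt (f (sq z) $ i))) \<longlongrightarrow> 0) ?F"
      using sqrt zero[of "sq z" i] z by (simp add: sq_def)
    then have "((\<lambda>z. lift_moduli f z $ i) \<longlongrightarrow> 0) ?F"
      by (rule Lim_null_comparison[rotated, OF tendsto_norm_zero])
        (auto simp: lift_moduli_def norm_mult norm_sgn)
    then show ?thesis using True by (simp add: lift_moduli_def)
  qed
qed

text \<open>\<open>A\<close> and \<open>B\<close> are the orbit spaces, and the vanishing coordinates determine the stabilisers.\<close>

lemma equivariantly_homeomorphic_sq_vimage:
  fixes A B :: "(real ^ 'm::finite) set"
  assumes hom: "homeomorphism A B f g"
    and A: "\<And>r i. r \<in> A \<Longrightarrow> 0 \<le> r $ i" and B: "\<And>y i. y \<in> B \<Longrightarrow> 0 \<le> y $ i"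
    and zero: "\<And>r i. r \<in> A \<Longrightarrow> f r $ i = 0 \<longleftrightarrow> r $ i = 0"
  shows "equivariantly_homeomorphic (sq -` A) (sq -` B)"
proof -
  have f: "f r \<in> B" "g (f r) = r" if "r \<in> A" for r
    using hom that by (auto simp: homeomorphism_def)
  have g: "g y \<in> A" "f (g y) = y" if "y \<in> B" for y
    using hom that by (auto simp: homeomorphism_def)
  have zero': "g y $ i = 0 \<longleftrightarrow> y $ i = 0" if "y \<in> B" for y i
    using zero[OF g(1)[OF that]] g(2)[OF that] by simp
  have sq_lift: "sq (lift_moduli h z) = h (sq z)"
    if "\<And>i. 0 \<le> h (sq z) $ i" "\<And>i. h (sq z) $ i = 0 \<longleftrightarrow> sq z $ i = 0" for h and z :: "complex ^ 'm"
    using that by (auto simp: sq_def lift_moduli_def vec_eq_iff norm_mult norm_sgn)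
  have inverse: "lift_moduli k (lift_moduli h z) = z"
    if "\<And>i. 0 \<le> h (sq z) $ i" "\<And>i. h (sq z) $ i = 0 \<longleftrightarrow> sq z $ i = 0" "k (h (sq z)) = sq z"
    for h k and z :: "complex ^ 'm"
  proof -
    \<comment> \<open>A positive factor preserves the phase, and where \<open>z $ i = 0\<close> both
      sides vanish.\<close>
    have "sgn (lift_moduli h z $ i) = sgn (z $ i)" for i
      using that(1,2)[of i] by (auto simp: lift_moduli_def sgn_mult sgn_of_real sq_def less_le)
    then have "lift_moduli k (lift_moduli h z) $ i = sgn (z $ i) * complex_of_real (cmod (z $ i))" for i
      unfolding lift_moduli_def[of k] sq_lift[of h z, OF that(1,2)] that(3) by (simp add: sq_def)
    moreover have "sgn w * complex_of_real (cmod w) = w" for w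
      by (cases "w = 0") (simp_all add: sgn_eq)
    ultimately show ?thesis by (simp add: vec_eq_iff)
  qed
  have sqf: "sq (lift_moduli f z) = f (sq z)" "lift_moduli g (lift_moduli f z) = z" if "sq z \<in> A" for z
    using that f B zero by (auto intro!: sq_lift inverse)
  have sqg: "sq (lift_moduli g z) = g (sq z)" "lift_moduli f (lift_moduli g z) = z" if "sq z \<in> B" for z
    using that g A zero' by (auto intro!: sq_lift inverse)
  have "homeomorphism (sq -` A) (sq -` B) (lift_moduli f) (lift_moduli g)"
  proof (rule homeomorphismI)
    show "continuous_on (sq -` A) (lift_moduli f)" "continuous_on (sq -` B) (lift_moduli g)"
      using hom zero zero' by (auto intro!: continuous_on_lift_moduli simp: homeomorphism_def)
  qed (use sqf sqg f g in auto)
  moreover have "lift_moduli f (torus_act t z) = torus_act t (lift_moduli f z)" if t: "t \<in> torus" for t z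
  proof -
    \<comment> \<open>The torus acts on the phases alone and leaves the squared moduli
      fixed.\<close>
    have "sgn (t $ i) = t $ i" for i using t by (simp add: torus_def sgn_div_norm)
    then show ?thesis
      unfolding lift_moduli_def sq_torus_act[OF t] by (simp add: torus_act_def sgn_mult mult.assoc)
  qed
  ultimately show ?thesis
    unfolding equivariantly_homeomorphic_def by (auto simp: sq_torus_act)
qed

section \<open>Facets and the normal fan\<close>

abbreviation real_normals :: "('m \<Rightarrow> int ^ 'n) \<Rightarrow> 'm \<Rightarrow> real ^ 'n" where
  "real_normals a \<equiv> (\<lambda>i. real_vec (a i))"

abbreviation tight :: "('m::finite \<Rightarrow> int ^ 'n::finite) \<Rightarrow> int ^ 'm \<Rightarrow> real ^ 'n \<Rightarrow> 'm set" where
  "tight a b p \<equiv> {i. p \<in> facet a b i}"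

lemma slack_real_vec: "slack (real_normals a) (real_vec b) x $ i = real_vec (a i) \<bullet> x + real_of_int (b $ i)"
  by (simp add: slack_def real_vec_def)

lemma polytope_of_slack: "polytope_of a b = {x. \<forall>i. 0 \<le> slack (real_normals a) (real_vec b) x $ i}"
  by (simp add: polytope_of_def slack_real_vec)

lemma mem_facet: "x \<in> facet a b i \<longleftrightarrow> x \<in> polytope_of a b \<and> slack (real_normals a) (real_vec b) x $ i = 0"
  by (simp add: facet_def slack_real_vec)

lemma polytope_of_halfspaces: "polytope_of a b = (\<Inter>i. {x. real_vec (a i) \<bullet> x \<ge> - real_of_int (b $ i)})"
proof -
  have "0 \<le> y + c \<longleftrightarrow> - c \<le> y" for y c :: real by linarith
  then show ?thesis by (simp add: polytope_of_def set_eq_iff)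
qed

lemma convex_polytope_of: "convex (polytope_of a b)"
  unfolding polytope_of_halfspaces by (simp add: convex_INT convex_halfspace_ge)

lemma closed_polytope_of: "closed (polytope_of a b)"
  unfolding polytope_of_halfspaces by (simp add: closed_INT closed_halfspace_ge)

lemma facet_face_of: "facet a b i face_of polytope_of a b"
proof -
  have "facet a b i = polytope_of a b \<inter> {x. real_vec (a i) \<bullet> x = - real_of_int (b $ i)}"
    unfolding facet_def by (simp add: add_eq_0_iff2)
  moreover have "x \<in> polytope_of a b \<Longrightarrow> real_vec (a i) \<bullet> x \<ge> - real_of_int (b $ i)" for x
    by (simp add: polytope_of_halfspaces)
  ultimately show ?thesis
    using face_of_Int_supporting_hyperplane_ge[OF convex_polytope_of] by metis
qed

lemma positive_slack_interior:
  assumes "\<And>i. 0 < slack (real_normals a) (real_vec b) x $ i"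
  shows "x \<in> interior (polytope_of a b)"
proof -
  let ?U = "{x. \<forall>i. 0 < slack (real_normals a) (real_vec b) x $ i}"
  have "open ?U"
  proof -
    have "?U = (\<Inter>i. {x. real_vec (a i) \<bullet> x > - real_of_int (b $ i)})"
    proof -
      have "0 < y + c \<longleftrightarrow> - c < y" for y c :: real by linarith
      then show ?thesis by (simp add: slack_real_vec set_eq_iff)
    qed
    then show ?thesis by (simp add: open_INT open_halfspace_gt)
  qed
  moreover have "?U \<subseteq> polytope_of a b" by (auto simp: polytope_of_slack less_imp_le)
  ultimately show ?thesis using assms by (auto intro: interiorI)
qed

section \<open>Faces and normals of an irredundant polytope\<close>

locale irredundant =
  fixes a :: "'m::finite \<Rightarrow> int ^ 'n::finite" and b :: "int ^ 'm"
  assumes nonzero: "\<And>i. a i \<noteq> 0" and irredundant: "irredundant_polytope a b"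
begin

abbreviation P where "P \<equiv> polytope_of a b"

lemma bounded_P: "bounded P" and affine_hull_P: "affine hull P = UNIV"
  and aff_dim_facet: "aff_dim (facet a b i) = int CARD('n) - 1"
  and card_facets: "card {F. F facet_of P} = CARD('m)"
  using irredundant by (auto simp: irredundant_polytope_def)

lemma compact_P: "compact P"
  using bounded_P closed_polytope_of compact_eq_bounded_closed by blast

lemma aff_dim_P: "aff_dim P = int CARD('n)"
  using affine_hull_P aff_dim_eq_full[of P] by simp

lemma facet_nonempty: "facet a b i \<noteq> {}"
proof
  assume "facet a b i = {}"
  then show False using aff_dim_facet[of i] by simp
qed

lemma interior_nonempty: "interior P \<noteq> {}"
  using affine_hull_P convex_polytope_of[of a b] rel_interior_eq_empty[of P] rel_interior_interior[of P]
  by (metis affine_hull_empty empty_not_UNIV)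

lemma interior_positive_slack:
  assumes "x \<in> interior P"
  shows "0 < slack (real_normals a) (real_vec b) x $ i"
proof -
  have "real_vec (a i) \<noteq> 0" using nonzero[of i] by (simp add: real_vec_def vec_eq_iff)
  then have "interior {x. real_vec (a i) \<bullet> x \<ge> - real_of_int (b $ i)} = {x. real_vec (a i) \<bullet> x > - real_of_int (b $ i)}"
    by (rule interior_halfspace_ge)
  moreover have "P \<subseteq> {x. real_vec (a i) \<bullet> x \<ge> - real_of_int (b $ i)}"
    unfolding polytope_of_halfspaces by blast
  ultimately have "x \<in> {x. real_vec (a i) \<bullet> x > - real_of_int (b $ i)}"
    using assms interior_mono by blast
  then show ?thesis by (simp add: slack_real_vec)
qed

text \<open>A relative interior point of a facet is not interior to \<open>P\<close>, hence lies on
  some bounding hyperplane. The facet is then a face of that \<open>facet a b i\<close>, and equal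
  dimensions force equality.\<close>

lemma facets_eq_range: "{F. F facet_of P} = range (facet a b)"
proof (intro equalityI subsetI)
  fix F assume "F \<in> {F. F facet_of P}"
  then have F: "F face_of P" "F \<noteq> {}" "aff_dim F = aff_dim P - 1" by (auto simp: facet_of_def)
  then have "F \<noteq> P" by auto
  obtain x where x: "x \<in> rel_interior F"
    using F rel_interior_eq_empty face_of_imp_convex by blast
  have xP: "x \<in> P" using x F(1) face_of_imp_subset rel_interior_subset by blast
  have "x \<notin> rel_interior P"
    using face_of_disjoint_rel_interior[OF F(1) \<open>F \<noteq> P\<close>] x rel_interior_subset by blast
  then have "x \<notin> interior P" using interior_subset_rel_interior by blast
  then obtain i where "\<not> 0 < slack (real_normals a) (real_vec b) x $ i"
    using positive_slack_interior by blast
  then have "x \<in> facet a b i"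
    using xP unfolding mem_facet polytope_of_slack by (auto simp: order.antisym not_less)
  then have sub: "F \<subseteq> facet a b i"
    using subset_of_face_of[OF facet_face_of] face_of_imp_subset[OF F(1)] x by blast
  then have "F face_of facet a b i"
    using face_of_subset[OF F(1)] face_of_imp_subset[OF facet_face_of] by blast
  then have "F = facet a b i"
    using face_of_aff_dim_lt[OF face_of_imp_convex[OF facet_face_of]] aff_dim_facet aff_dim_P F(3)
    by force
  then show "F \<in> range (facet a b)" by blast
next
  fix F assume "F \<in> range (facet a b)"
  then show "F \<in> {F. F facet_of P}"
    using facet_face_of facet_nonempty aff_dim_facet aff_dim_P by (auto simp: facet_of_def)
qed

text \<open>There are as many facets as indices, so the surjection from indices to facets is
  injective.\<close>

lemma inj_facet: "inj (facet a b)"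
  using card_facets unfolding facets_eq_range by (intro eq_card_imp_inj_on) auto

text \<open>For \<open>p \<in> P\<close> this is the smallest face containing \<open>p\<close>; the
  factor \<open>P\<close> covers points on no facet.\<close>

definition carrier_face :: "real ^ 'n \<Rightarrow> (real ^ 'n) set" where
  "carrier_face p = P \<inter> (\<Inter>i\<in>tight a b p. facet a b i)"

lemma carrier_face_face_of: "carrier_face p face_of P"
proof -
  have "carrier_face p = \<Inter> (insert P (facet a b ` tight a b p))" by (auto simp: carrier_face_def)
  also have "\<dots> face_of P"
    by (rule face_of_Inter) (auto intro: facet_face_of face_of_refl convex_polytope_of)
  finally show ?thesis .
qed

lemma mem_carrier_face: "p \<in> P \<Longrightarrow> p \<in> carrier_face p"
  by (auto simp: carrier_face_def)

text \<open>Any vertex of the carrier face of \<open>p\<close> serves. This carries simplicity, a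
  condition on vertices, over to all points of \<open>P\<close>.\<close>

lemma tight_mono_extreme_point:
  assumes "p \<in> P"
  obtains v where "v extreme_point_of P" "tight a b p \<subseteq> tight a b v"
proof -
  obtain v where "v extreme_point_of carrier_face p"
    using extreme_point_exists_convex face_of_imp_compact[OF convex_polytope_of compact_P carrier_face_face_of]
      face_of_imp_convex[OF carrier_face_face_of] mem_carrier_face[OF assms] by blast
  then have "v extreme_point_of P" "v \<in> carrier_face p"
    using extreme_point_of_face[OF carrier_face_face_of] by auto
  then show thesis using that by (auto simp: carrier_face_def)
qed

text \<open>A nonzero direction orthogonal to all tight normals would allow a small move from
  \<open>v\<close> both ways inside \<open>P\<close>, making \<open>v\<close> a midpoint.\<close>

lemma normals_at_extreme_point:
  assumes "v extreme_point_of P"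
  shows "span (real_normals a ` tight a b v) = UNIV"
proof (rule ccontr)
  let ?h = "slack (real_normals a) (real_vec b)"
  assume "span (real_normals a ` tight a b v) \<noteq> UNIV"
  then obtain u where u: "u \<noteq> 0" "\<And>x. x \<in> span (real_normals a ` tight a b v) \<Longrightarrow> u \<bullet> x = 0"
    using span_not_UNIV_orthogonal by blast
  have vP: "v \<in> P" using assms by (simp add: extreme_point_of_def)
  have "\<forall>\<^sub>F t in nhds 0. 0 \<le> ?h v $ i + t * (real_vec (a i) \<bullet> u)" for i
  proof (cases "i \<in> tight a b v")
    case True
    then have "real_vec (a i) \<bullet> u = 0" using u(2)[of "real_vec (a i)"] span_base by (metis image_eqI inner_commute)
    then show ?thesis using True by (simp add: mem_facet)
  next
    case False
    then have "0 < ?h v $ i" using vP by (auto simp: mem_facet polytope_of_slack less_le)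
    moreover have "((\<lambda>t. ?h v $ i + t * (real_vec (a i) \<bullet> u)) \<longlongrightarrow> ?h v $ i + 0 * (real_vec (a i) \<bullet> u)) (nhds 0)"
      by (intro tendsto_intros filterlim_ident)
    ultimately have "\<forall>\<^sub>F t in nhds 0. 0 < ?h v $ i + t * (real_vec (a i) \<bullet> u)"
      by (intro order_tendstoD) auto
    then show ?thesis by eventually_elim simp
  qed
  then have "\<forall>\<^sub>F t in nhds 0. \<forall>i. 0 \<le> ?h v $ i + t * (real_vec (a i) \<bullet> u)"
    by (rule eventually_all_finite)
  then obtain e where e: "0 < e" "\<And>t i. \<bar>t\<bar> < e \<Longrightarrow> 0 \<le> ?h v $ i + t * (real_vec (a i) \<bullet> u)"
    unfolding eventually_nhds_metric by (auto simp: dist_real_def)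
  have "v + t *\<^sub>R u \<in> P" if "\<bar>t\<bar> < e" for t
    using e(2)[OF that] by (simp add: polytope_of_slack slack_add_scaleR)
  from this[of "e / 2"] this[of "- (e / 2)"] e(1)
  have "v + (e / 2) *\<^sub>R u \<in> P" "v - (e / 2) *\<^sub>R u \<in> P" by auto
  moreover have "midpoint (v + (e / 2) *\<^sub>R u) (v - (e / 2) *\<^sub>R u) = v"
    by (simp add: midpoint_def scaleR_right_distrib[symmetric] scaleR_2[symmetric])
  then have "v \<in> open_segment (v + (e / 2) *\<^sub>R u) (v - (e / 2) *\<^sub>R u)"
    using midpoint_in_open_segment[of "v + (e / 2) *\<^sub>R u" "v - (e / 2) *\<^sub>R u"] e(1) u(1)
    by (simp add: eq_diff_eq add.assoc flip: scaleR_left_distrib)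
  ultimately show False using assms unfolding extreme_point_of_def by blast
qed

text \<open>At a vertex there are exactly n tight normals and they span, so they are independent; a
  relation supported at \<open>p\<close> is also supported at such a vertex.\<close>

lemma independent_normals:
  assumes simple: "simple_polytope P" and "p \<in> P"
    and \<gamma>: "(\<Sum>i\<in>UNIV. \<gamma> $ i *\<^sub>R real_vec (a i)) = 0" and supp: "\<And>i. \<gamma> $ i \<noteq> 0 \<Longrightarrow> p \<in> facet a b i"
  shows "\<gamma> = 0"
proof -
  obtain v where v: "v extreme_point_of P" "tight a b p \<subseteq> tight a b v"
    using tight_mono_extreme_point[OF \<open>p \<in> P\<close>] by blast
  let ?I = "tight a b v" and ?A = "real_normals a"
  have "{F. F facet_of P \<and> v \<in> F} = facet a b ` ?I"
    using facets_eq_range by blast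
  then have "card (facet a b ` ?I) = CARD('n)"
    using simple v(1) by (auto simp: simple_polytope_def)
  then have card_I: "card ?I = CARD('n)"
    using card_image[OF inj_on_subset[OF inj_facet subset_UNIV]] by metis
  have "dim (UNIV :: (real ^ 'n) set) \<le> card (?A ` ?I)"
    using normals_at_extreme_point[OF v(1)] by (intro dim_le_card) auto
  \<comment> \<open>A spanning set has at least n elements, so the n tight indices have pairwise
    distinct normals.\<close>
  then have eq: "card (?A ` ?I) = card ?I"
    using card_image_le[of ?I ?A] card_I by (simp add: dim_UNIV)
  then have inj: "inj_on ?A ?I" by (simp add: eq_card_imp_inj_on)
  have indep: "independent (?A ` ?I)"
    using card_le_dim_spanning[of "?A ` ?I" UNIV] normals_at_extreme_point[OF v(1)] eq card_I
    by (simp add: dim_UNIV)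
  have "(\<Sum>x\<in>?A ` ?I. \<gamma> $ (inv_into ?I ?A x) *\<^sub>R x) = (\<Sum>i\<in>?I. \<gamma> $ i *\<^sub>R ?A i)"
    by (simp add: sum.reindex[OF inj] inv_into_f_f[OF inj])
  also have "\<dots> = (\<Sum>i\<in>UNIV. \<gamma> $ i *\<^sub>R ?A i)"
    using supp v(2) by (intro sum.mono_neutral_left) auto
  finally have "\<gamma> $ (inv_into ?I ?A (?A i)) = 0" if "i \<in> ?I" for i
    using independentD[OF indep, of "?A ` ?I" "\<lambda>x. \<gamma> $ (inv_into ?I ?A x)" "?A i"] that \<gamma> by simp
  then have "\<gamma> $ i = 0" if "i \<in> ?I" for i using that inv_into_f_f[OF inj] by simp
  then show ?thesis using supp v(2) by (auto simp: vec_eq_iff)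
qed

lemma slack_polytope_eq:
  "slack_polytope (real_normals a) (real_vec b) = slack (real_normals a) (real_vec b) ` P"
  by (simp add: slack_polytope_def polytope_of_slack)

lemma simple_slack_polytope:
  assumes "simple_polytope P"
  shows "simple_slack_polytope (real_normals a) (real_vec b)"
proof
  show "bounded {x. \<forall>i. 0 \<le> slack (real_normals a) (real_vec b) x $ i}"
    using bounded_P by (simp add: polytope_of_slack)
  show "\<exists>x. \<forall>i. 0 < slack (real_normals a) (real_vec b) x $ i"
    using interior_nonempty interior_positive_slack by blast
next
  fix \<gamma> y
  assume "\<gamma> \<in> relations (real_normals a)" "y \<in> slack_polytope (real_normals a) (real_vec b)"
    and supp: "\<And>i. \<gamma> $ i \<noteq> 0 \<Longrightarrow> y $ i = 0"
  then obtain p where "p \<in> P" "y = slack (real_normals a) (real_vec b) p"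
    "(\<Sum>i\<in>UNIV. \<gamma> $ i *\<^sub>R real_vec (a i)) = 0"
    by (auto simp: slack_polytope_eq relations_def)
  then show "\<gamma> = 0"
    using independent_normals[OF assms] supp by (simp add: mem_facet)
qed

section \<open>Generators of the normal cones and the Kempf--Ness set\<close>

text \<open>Subtracting from \<open>a i\<close> its expansion over the normals of the cone gives a
  relation positive at most at \<open>i\<close> and negative only at facets through
  \<open>q\<close>. Separation between a point of the i-th facet and \<open>q\<close> kills it, so
  \<open>i\<close> itself occurs in the expansion.\<close>

lemma generator_indices_imp_tight:
  assumes simple: "simple_polytope P" and "Q \<subseteq> P" "q \<in> Q"
    and i: "i \<in> generator_indices a (normal_cone a b Q)"
  shows "q \<in> facet a b i"
proof -
  interpret simple_slack_polytope "real_normals a" "real_vec b"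
    using simple by (rule simple_slack_polytope)
  let ?h = "slack (real_normals a) (real_vec b)" and ?J = "{j. Q \<subseteq> facet a b j}"
  have "real_vec (a i) \<in> convex_cone hull (real_normals a ` ?J)"
    using i face_of_imp_subset hull_inc[of "real_vec (a i)" "{real_vec (a i)}"]
    unfolding generator_indices_def normal_cone_def by blast
  then obtain c where c: "\<And>j. 0 \<le> c j" "\<And>j. j \<notin> ?J \<Longrightarrow> c j = 0"
    and ai: "real_vec (a i) = (\<Sum>j\<in>UNIV. c j *\<^sub>R real_vec (a j))"
    using in_convex_cone_hull_imageE by blast
  obtain x where x: "x \<in> facet a b i" using facet_nonempty by blast
  define \<gamma> :: "real ^ 'm" where "\<gamma> = (\<chi> j. (if j = i then 1 else 0) - c j)"
  have "(\<Sum>j\<in>UNIV. (if j = i then 1 else 0) *\<^sub>R real_vec (a j)) = real_vec (a i)"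
    by (simp add: if_distrib[of "\<lambda>c. c *\<^sub>R _"] cong: if_cong)
  then have rel: "\<gamma> \<in> relations (real_normals a)"
    using ai by (simp add: relations_def \<gamma>_def scaleR_left_diff_distrib sum_subtractf)
  have "x \<in> P" "q \<in> P" using x assms(2,3) by (auto simp: mem_facet)
  moreover have "?h x $ j = 0" if "0 < \<gamma> $ j" for j
    using that x c(1)[of j] by (cases "j = i") (auto simp: \<gamma>_def mem_facet)
  moreover have "?h q $ j = 0" if "\<gamma> $ j < 0" for j
  proof -
    have "c j \<noteq> 0" using that by (auto simp: \<gamma>_def split: if_splits)
    then have "q \<in> facet a b j" using c(2)[of j] assms(3) by blast
    then show ?thesis by (simp add: mem_facet)
  qed
  ultimately have "\<gamma> = 0"
    using relation_separated_zero[OF rel, of "?h x" "?h q"] by (auto simp: slack_polytope_eq)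
  then have "\<gamma> $ i = 0" by simp
  then have "c i \<noteq> 0" by (simp add: \<gamma>_def)
  then show ?thesis using c(2)[of i] assms(3) by blast
qed

text \<open>Independent normals make coefficients in the cone unique. If a point of the ray lies
  strictly between \<open>x\<close> and \<open>y\<close>, their nonnegative coefficients away from
  \<open>i\<close> must vanish.\<close>

lemma tight_imp_generator_indices:
  assumes simple: "simple_polytope P" and p: "p \<in> P" and i: "p \<in> facet a b i"
  shows "i \<in> generator_indices a (normal_cone a b (carrier_face p))"
proof -
  let ?A = "real_normals a"
  let ?S = "convex_cone hull (?A ` tight a b p)" and ?T = "convex_cone hull {?A i}"
  have "{j. carrier_face p \<subseteq> facet a b j} = tight a b p"
    using mem_carrier_face[OF p] by (auto simp: carrier_face_def)
  then have "normal_cone a b (carrier_face p) = ?S" by (simp add: normal_cone_def)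
  moreover have "?T face_of ?S"
    unfolding face_of_def
  proof (intro conjI ballI impI)
    show "?T \<subseteq> ?S" using i by (intro hull_mono) auto
    show "convex ?T" by (rule convex_convex_cone_hull)
    fix x y w assume "x \<in> ?S" "y \<in> ?S" "w \<in> ?T" and "w \<in> open_segment x y"
    then obtain t where t: "0 < t" "t < 1" "w = (1 - t) *\<^sub>R x + t *\<^sub>R y"
      by (auto simp: in_segment)
    obtain c where c: "\<And>j. 0 \<le> c j" "\<And>j. j \<notin> tight a b p \<Longrightarrow> c j = 0" "x = (\<Sum>j\<in>UNIV. c j *\<^sub>R ?A j)"
      using \<open>x \<in> ?S\<close> by (rule in_convex_cone_hull_imageE) blast
    obtain d where d: "\<And>j. 0 \<le> d j" "\<And>j. j \<notin> tight a b p \<Longrightarrow> d j = 0" "y = (\<Sum>j\<in>UNIV. d j *\<^sub>R ?A j)"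
      using \<open>y \<in> ?S\<close> by (rule in_convex_cone_hull_imageE) blast
    have "w \<in> convex_cone hull (?A ` {i})" using \<open>w \<in> ?T\<close> by simp
    then obtain e where e: "\<And>j. j \<notin> {i} \<Longrightarrow> e j = 0" "w = (\<Sum>j\<in>UNIV. e j *\<^sub>R ?A j)"
      by (rule in_convex_cone_hull_imageE) blast
    define \<gamma> :: "real ^ 'm" where "\<gamma> = (\<chi> j. (1 - t) * c j + t * d j - e j)"
    have "(\<Sum>j\<in>UNIV. \<gamma> $ j *\<^sub>R ?A j) = (1 - t) *\<^sub>R x + t *\<^sub>R y - w"
      by (simp add: \<gamma>_def c(3) d(3) e(2) scaleR_left_distrib scaleR_left_diff_distrib scaleR_sum_right
          sum.distrib sum_subtractf)
    then have "(\<Sum>j\<in>UNIV. \<gamma> $ j *\<^sub>R ?A j) = 0" using t(3) by simp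
    moreover have "p \<in> facet a b j" if "\<gamma> $ j \<noteq> 0" for j
    proof (rule ccontr)
      assume "p \<notin> facet a b j"
      moreover from this have "j \<noteq> i" using i by blast
      ultimately have "c j = 0" "d j = 0" "e j = 0" using c(2) d(2) e(1) by auto
      then show False using that by (simp add: \<gamma>_def)
    qed
    ultimately have "\<gamma> = 0" using independent_normals[OF simple p] by blast
    have "c j = 0 \<and> d j = 0" if "j \<noteq> i" for j
    proof -
      have "\<gamma> $ j = 0" using \<open>\<gamma> = 0\<close> by simp
      then have "(1 - t) * c j + t * d j = 0" using e(1)[of j] that by (simp add: \<gamma>_def)
      moreover have "0 \<le> (1 - t) * c j" "0 \<le> t * d j" using t c(1) d(1) by simp_all
      ultimately have "(1 - t) * c j = 0" "t * d j = 0" by linarith+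
      then show ?thesis using t by simp
    qed
    then have "x = c i *\<^sub>R ?A i" "y = d i *\<^sub>R ?A i"
      unfolding c(3) d(3) by (auto intro!: sum.mono_neutral_left[of UNIV "{i}", simplified, symmetric] simp: sum.remove[of UNIV i])
    then show "x \<in> ?T" "y \<in> ?T"
      using c(1) d(1) by (auto intro: convex_cone_hull_mul hull_inc)
  qed
  ultimately show ?thesis by (simp add: generator_indices_def)
qed

text \<open>Cones are traded for points: a face \<open>Q\<close> gives any \<open>q \<in> Q\<close>,
  and a point \<open>p\<close> gives its carrier face, among whose generators are all indices tight
  at \<open>p\<close>.\<close>

lemma kempf_ness_set_eq:
  assumes simple: "simple_polytope P"
  shows "kempf_ness_set a (normal_fan a b) = sq -` cube_complex (slack_polytope (real_normals a) (real_vec b))"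
proof -
  have less_1: "(cmod w)\<^sup>2 < 1 \<longleftrightarrow> cmod w < 1" and le_1: "(cmod w)\<^sup>2 \<le> 1 \<longleftrightarrow> cmod w \<le> 1" for w
    using abs_square_less_1[of "cmod w"] abs_square_le_1[of "cmod w"] by simp_all
  have "z \<in> kempf_ness_set a (normal_fan a b) \<longleftrightarrow>
      (\<forall>j. cmod (z $ j) \<le> 1) \<and> (\<exists>p\<in>P. \<forall>j. cmod (z $ j) < 1 \<longrightarrow> p \<in> facet a b j)" for z
  proof
    assume "z \<in> kempf_ness_set a (normal_fan a b)"
    then obtain Q where Q: "Q face_of P" "Q \<noteq> {}" and le: "\<And>j. cmod (z $ j) \<le> 1"
      and eq: "\<And>j. j \<notin> generator_indices a (normal_cone a b Q) \<Longrightarrow> cmod (z $ j) = 1"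
      unfolding kempf_ness_set_def normal_fan_def by blast
    obtain q where "q \<in> Q" using Q by blast
    then have "q \<in> facet a b j" if "cmod (z $ j) < 1" for j
      using generator_indices_imp_tight[OF simple face_of_imp_subset[OF Q(1)]] eq[of j] that by fastforce
    then show "(\<forall>j. cmod (z $ j) \<le> 1) \<and> (\<exists>p\<in>P. \<forall>j. cmod (z $ j) < 1 \<longrightarrow> p \<in> facet a b j)"
      using le \<open>q \<in> Q\<close> face_of_imp_subset[OF Q(1)] by blast
  next
    assume "(\<forall>j. cmod (z $ j) \<le> 1) \<and> (\<exists>p\<in>P. \<forall>j. cmod (z $ j) < 1 \<longrightarrow> p \<in> facet a b j)"
    then obtain p where le: "\<And>j. cmod (z $ j) \<le> 1" and p: "p \<in> P" "\<And>j. cmod (z $ j) < 1 \<Longrightarrow> p \<in> facet a b j"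
      by blast
    have "cmod (z $ j) = 1" if "j \<notin> generator_indices a (normal_cone a b (carrier_face p))" for j
      using tight_imp_generator_indices[OF simple p(1)] p(2)[of j] le[of j] that by fastforce
    moreover have "normal_cone a b (carrier_face p) \<in> normal_fan a b"
      unfolding normal_fan_def using carrier_face_face_of mem_carrier_face[OF p(1)] by blast
    ultimately show "z \<in> kempf_ness_set a (normal_fan a b)"
      unfolding kempf_ness_set_def using le by blast
  qed
  then show ?thesis
    by (auto simp: cube_complex_def sq_def slack_polytope_eq mem_facet less_1 le_1)
qed

end

section \<open>The level set of the moment map and the conclusion\<close>

text \<open>By exactness the fibre of \<open>C\<close> over \<open>C *v real_vec b\<close> consists
  of the slack vectors of all points; squared moduli are nonnegative, which restricts to points of
  the polytope.\<close>

lemma moment_map_vimage: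
  assumes "cokernel_matrix a C"
  shows "moment_map C -` {C *v real_vec b} = sq -` slack_polytope (real_normals a) (real_vec b)"
proof -
  have "C *v y = C *v real_vec b \<longleftrightarrow> y \<in> range (slack (real_normals a) (real_vec b))" for y
  proof -
    have "C *v y = C *v real_vec b \<longleftrightarrow> y - real_vec b \<in> range (A_map a)"
      using assms by (simp add: cokernel_matrix_def matrix_vector_mult_diff_distrib)
    moreover have "y - real_vec b = A_map a x \<longleftrightarrow> y = slack (real_normals a) (real_vec b) x" for x
      by (simp add: vec_eq_iff A_map_def slack_def diff_eq_eq)
    ultimately show ?thesis by auto
  qed
  then have "moment_map C z = C *v real_vec b \<longleftrightarrow> sq z \<in> slack_polytope (real_normals a) (real_vec b)" for z
    unfolding moment_map_def slack_polytope_def sq_def[symmetric]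
    by (auto simp: image_iff) (metis sq_def vec_lambda_beta zero_le_power2)
  then show ?thesis by auto
qed

theorem proposition5p2:
  fixes a :: "'m::finite \<Rightarrow> int ^ 'n::finite"
    and b :: "int ^ 'm"
    and C :: "real ^ 'm ^ 'k::finite"
  assumes "\<And>i. primitive_vec (a i)"
    and "irredundant_polytope a b"
    and "simple_polytope (polytope_of a b)"
    and "cokernel_matrix a C"
  shows "equivariantly_homeomorphic
           (kempf_ness_set a (normal_fan a b))
           (moment_map C -` {C *v real_vec b})"
proof -
  interpret irredundant a b
    using assms(1,2) by unfold_locales (auto simp: primitive_vec_def)
  interpret simple_slack_polytope "real_normals a" "real_vec b"
    using assms(3) by (rule simple_slack_polytope)
  obtain f g where "homeomorphism cubes H f g" "\<And>r i. r \<in> cubes \<Longrightarrow> f r $ i = 0 \<longleftrightarrow> r $ i = 0"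
    using cubes_homeomorphism by blast
  moreover have "0 \<le> r $ i" if "r \<in> cubes" for r i
    using that by (simp add: cube_complex_def)
  ultimately have "equivariantly_homeomorphic (sq -` cubes) (sq -` H)"
    using slack_nonneg by (intro equivariantly_homeomorphic_sq_vimage[of cubes H f g])
  then show ?thesis
    by (simp add: kempf_ness_set_eq[OF assms(3)] moment_map_vimage[OF assms(4)])
qed

end
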